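(* Let $n\ge2$, let $C_1,\dots,C_n\in\mathcal C$ and $C\in\mathcal C$, and let $g:\mathbb R^2\to\mathbb R^2$ be any similarity transformation, $g(x)=rQx+b$ with $r>0$, $Q\in O(2)$ and $b\in\mathbb R^2$. Then $$D_\bullet(C\mid\{C_i\})=D_\bullet(g(C)\mid\{g(C_i)\})\quad\text{for each}\quad D_\bullet\in\{D_{\mathrm{int}},D_{\mathrm{inf}},D_{\mathrm{FW}},D_{\mathrm{FW}}^{\inf}\}.$$
   Context: Curve space. Let $\mathbb S^1=[0,1]/\{0\sim1\}$ and $I\in\{[0,1],\mathbb S^1\}$. $\mathcal F(I)$ is the set of continuous maps $f:I\to\mathbb R^2$ of finite length $L(f)=\sup\sum_j\|f(\tau_j)-f(\tau_{j-1})\|_2$ (supremum over partitions $0=\tau_0<\dots<\tau_J=1$) whose arc-length map $s_f(t)=L(f|_{[0,t]})$ is strictly increasing (for $I=\mathbb S^1$, $f$ is identified with a continuous map on $[0,1]$ with $f(0)=f(1)$). Write $f_1\sim f_2$ if $f_1=f_2\circ\phi$ for an orientation-preserving or orientation-reversing homeomorphism $\phi:I\to I$. The curve space is $\mathcal C=(\mathcal F([0,1])/\!\sim)\sqcup(\mathcal F(\mathbb S^1)/\!\sim)$; elements of the first part are called open, of the second part closed. For $C\in\mathcal C$, the length $L(C)=L(f)$ and the trace $\Gamma_C=f(I)$ do not depend on the representative $f\in C$. Standing assumption: $L(C)>0$ for all curves considered. In set-theoretic expressions $C$ is identified with $\Gamma_C$. For a similarity $g$, $g(C)\in\mathcal C$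 is the class of $g\circ f$ for any representative $f$ of $C$. Arc-length representative and measure. An arc-length representative of $C$ is $\beta_C^{\mathrm{arc}}=f\circ s_f^{-1}$ on $[0,L(C)]$ (with $0\sim L(C)$ identified if $C$ is closed), for a representative $f$ of $C$; it is unique up to orientation reversal (open case), or up to circular shift and reversal (closed case). The arc-length probability measure is $\mu_C(B)=\frac1{L(C)}\int_0^{L(C)}\mathbf 1_B(\beta_C^{\mathrm{arc}}(s))\,ds$ for Borel $B\subseteq\mathbb R^2$; it depends only on $C$ and is assumed non-atomic. Global band: $\mathcal R(A,B)=\{(1-\lambda)x+\lambda y: x\in\Gamma_A,\ y\in\Gamma_B,\ \lambda\in[0,1]\}$. Fast-walk (FW) band. Put $\beta_C(t)=\beta_C^{\mathrm{arc}}(L(C)t)$ on $[0,1]$ or $\mathbb S^1$. If $C$ is open, $\mathcal G(C)=\{\beta_C,\beta_C^{\leftarrow}\}$ with $\beta_C^{\leftarrow}(t)=\beta_C(1-t)$. If $C$ is closed, $\mathcal G(C)=\{\beta_C^\theta,(\beta_C^\theta)^{\leftarrow}:\theta\in\mathbb S^1\}$ with $\beta_C^\theta(t)=\beta_C(t+\theta \bmod 1)$ and $(\beta_C^\theta)^{\leftarrow}(t)=\beta_C(\theta-t \bmod 1)$ (so each element has equal values at $0$ and $1$). For $\alpha\in\mathcal G(A)$, $\beta\in\mathcal G(B)$, let $\gamma_{\alpha,\beta}:\mathbb S^1\to\mathbb R^2$ be the closed loop obtained by concatenating $\alpha$ on $[0,1]$, the segment from $\alpha(1)$ to $\beta(1)$,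 $\beta$ traversed in reverse, and the segment from $\beta(0)$ to $\alpha(0)$ (each on a quarter of $\mathbb S^1$), and let $W(\alpha,\beta)$ be its image. For $p\notin W(\alpha,\beta)$ let $n_2(\gamma_{\alpha,\beta};p)\in\{0,1\}$ be the degree of $t\mapsto(\gamma_{\alpha,\beta}(t)-p)/\|\gamma_{\alpha,\beta}(t)-p\|$ reduced mod $2$. Set $E(\alpha,\beta)=W(\alpha,\beta)\cup\{p\notin W(\alpha,\beta): n_2(\gamma_{\alpha,\beta};p)=1\}$ and $\Delta(\alpha,\beta)=\|\alpha(1)-\beta(1)\|_2+\|\alpha(0)-\beta(0)\|_2$; let $\mathcal M(A,B)$ be the set of minimizers of $\Delta$ over $\mathcal G(A)\times\mathcal G(B)$. The FW band is $R_{\mathrm{FW}}(A,B)=\mathrm{cl}\bigl(\bigcup_{(\alpha,\beta)\in\mathcal M(A,B)}E(\alpha,\beta)\bigr)$. Depths. For a band $\mathcal R_b\in\{\mathcal R,R_{\mathrm{FW}}\}$: the integral depth is $\binom n2^{-1}\sum_{1\le i<j\le n}\mu_C(\mathcal R_b(C_i,C_j))$ and the infimal depth is $\binom n2^{-1}\sum_{1\le i<j\le n}\mathbf 1\{\mu_C(\mathcal R_b(C_i,C_j))=1\}$. For $\mathcal R_b=\mathcal R$ they are denoted $D_{\mathrm{int}}(C\mid\{C_i\})$ and $D_{\mathrm{inf}}(C\mid\{C_i\})$; for $\mathcal R_b=R_{\mathrm{FW}}$ they are denoted $D_{\mathrm{FW}}(C\mid\{C_i\})$ and $D_{\mathrm{FW}}^{\inf}(C\mid\{C_i\})$.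 *)

theory Defs
  imports "HOL-Complex_Analysis.Complex_Analysis"
begin

type_synonym plane = "real ^ 2"

text \<open>
  Parametrized curves are functions of type \<open>real \<Rightarrow> plane\<close> of which only the values on
  \<open>{0..1}\<close> matter; the equivalence relations below ignore all other values. A map on the circle
  \<open>[0,1]/{0 ~ 1}\<close> is a map on \<open>{0..1}\<close> with equal values at 0 and 1.
\<close>

definition polygonal_lengths :: "(real \<Rightarrow> plane) \<Rightarrow> real \<Rightarrow> real \<Rightarrow> real set" where
  "polygonal_lengths f a b =
     {\<Sum>j<J. norm (f (\<tau> (Suc j)) - f (\<tau> j)) | (J :: nat) (\<tau> :: nat \<Rightarrow> real).
        \<tau> 0 = a \<and> \<tau> J = b \<and> (\<forall>j<J. \<tau> j < \<tau> (Suc j))}"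

text \<open>
  A real supremum, hence meaningful only when the polygonal lengths are bounded, which
  \<open>param_curves\<close> requires. For \<open>a = b\<close> the only partition has \<open>J = 0\<close>, which gives length 0.
\<close>

definition path_length :: "(real \<Rightarrow> plane) \<Rightarrow> real \<Rightarrow> real \<Rightarrow> real" where
  "path_length f a b = Sup (polygonal_lengths f a b)"

definition arc_length_map :: "(real \<Rightarrow> plane) \<Rightarrow> real \<Rightarrow> real" where
  "arc_length_map f t = path_length f 0 t"

definition param_curves :: "(real \<Rightarrow> plane) set" where
  "param_curves =
     {f. continuous_on {0..1} f \<and> bdd_above (polygonal_lengths f 0 1) \<and>
         strict_mono_on {0..1} (arc_length_map f)}"

definition param_loops :: "(real \<Rightarrow> plane) set" where
  "param_loops = {f \<in> param_curves. f 0 = f 1}"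

text \<open>
  Every homeomorphism of the interval or of the circle either preserves or reverses the
  orientation, so reparametrizations range over all homeomorphisms. The circle
  \<open>[0,1]/{0 ~ 1}\<close> is identified with the unit circle through \<open>t \<mapsto> cis (2 * pi * t)\<close>.
\<close>

definition open_rel :: "((real \<Rightarrow> plane) \<times> (real \<Rightarrow> plane)) set" where
  "open_rel =
     {(f1, f2). f1 \<in> param_curves \<and> f2 \<in> param_curves \<and>
        (\<exists>\<phi> \<psi>. homeomorphism {0..1} {0..1} \<phi> \<psi> \<and> (\<forall>t\<in>{0..1}. f1 t = f2 (\<phi> t)))}"

definition closed_rel :: "((real \<Rightarrow> plane) \<times> (real \<Rightarrow> plane)) set" where
  "closed_rel =
     {(f1, f2). f1 \<in> param_loops \<and> f2 \<in> param_loops \<and>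
        (\<exists>\<phi> \<psi>. homeomorphism (sphere (0::complex) 1) (sphere 0 1) \<phi> \<psi> \<and>
           (\<forall>t\<in>{0..1}. \<forall>u\<in>{0..1}. cis (2 * pi * u) = \<phi> (cis (2 * pi * t)) \<longrightarrow> f1 t = f2 u))}"

text \<open>Open curves are tagged \<open>Inl\<close>, closed curves \<open>Inr\<close>.\<close>

type_synonym curve = "(real \<Rightarrow> plane) set + (real \<Rightarrow> plane) set"

definition curve_space :: "curve set" where
  "curve_space = (param_curves // open_rel) <+> (param_loops // closed_rel)"

definition representative :: "curve \<Rightarrow> real \<Rightarrow> plane" where
  "representative C = (SOME f. f \<in> (case C of Inl c \<Rightarrow> c | Inr c \<Rightarrow> c))"

definition curve_length :: "curve \<Rightarrow> real" where
  "curve_length C = path_length (representative C) 0 1"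

definition trace_of :: "curve \<Rightarrow> plane set" where
  "trace_of C = representative C ` {0..1}"

text \<open>
  For a similarity \<open>g\<close> this is the class of \<open>g \<circ> f\<close> for any representative \<open>f\<close> of \<open>C\<close>; taking the
  union over all representatives avoids a choice.
\<close>

definition curve_image :: "(plane \<Rightarrow> plane) \<Rightarrow> curve \<Rightarrow> curve" where
  "curve_image g C =
     map_sum (\<lambda>c. open_rel `` {g \<circ> f | f. f \<in> c}) (\<lambda>c. closed_rel `` {g \<circ> f | f. f \<in> c}) C"

definition arc_rep :: "curve \<Rightarrow> real \<Rightarrow> plane" where
  "arc_rep C s =
     representative C (the_inv_into {0..1} (arc_length_map (representative C)) s)"

definition arc_measure :: "curve \<Rightarrow> plane set \<Rightarrow> real" where
  "arc_measure C B =
     (1 / curve_length C) * (LINT s:{0..curve_length C}|lborel. indicator B (arc_rep C s))"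

definition non_atomic :: "(plane set \<Rightarrow> real) \<Rightarrow> bool" where
  "non_atomic \<mu> \<longleftrightarrow>
     \<not> (\<exists>A\<in>sets borel. \<mu> A > 0 \<and> (\<forall>B\<in>sets borel. B \<subseteq> A \<longrightarrow> \<mu> B = 0 \<or> \<mu> B = \<mu> A))"

definition global_band :: "curve \<Rightarrow> curve \<Rightarrow> plane set" where
  "global_band A B =
     {(1 - l) *\<^sub>R x + l *\<^sub>R y | l x y. x \<in> trace_of A \<and> y \<in> trace_of B \<and> l \<in> {0..1}}"

definition unit_rep :: "curve \<Rightarrow> real \<Rightarrow> plane" where
  "unit_rep C t = arc_rep C (curve_length C * t)"

definition traversals :: "curve \<Rightarrow> (real \<Rightarrow> plane) set" where
  "traversals C =
     (case C of
        Inl _ \<Rightarrow> {unit_rep C, \<lambda>t. unit_rep C (1 - t)}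
      | Inr _ \<Rightarrow> (\<Union>\<theta>\<in>{0..<1}. {\<lambda>t. unit_rep C (frac (t + \<theta>)), \<lambda>t. unit_rep C (frac (\<theta> - t))}))"

definition band_loop :: "(real \<Rightarrow> plane) \<Rightarrow> (real \<Rightarrow> plane) \<Rightarrow> real \<Rightarrow> plane" where
  "band_loop \<alpha> \<beta> =
     (\<alpha> +++ linepath (\<alpha> 1) (\<beta> 1)) +++ (reversepath \<beta> +++ linepath (\<beta> 0) (\<alpha> 0))"

definition band_wall :: "(real \<Rightarrow> plane) \<Rightarrow> (real \<Rightarrow> plane) \<Rightarrow> plane set" where
  "band_wall \<alpha> \<beta> = path_image (band_loop \<alpha> \<beta>)"

text \<open>
  The degree of a loop \<open>u\<close> in the unit circle, the plane being identified with the complex numbers,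
  is the winding number of \<open>u\<close> around 0. The library's \<open>winding_number\<close> is complex-valued and an
  integer on loops, so \<open>\<lfloor>Re _\<rfloor>\<close> only changes its type.
\<close>

definition circle_degree :: "(real \<Rightarrow> plane) \<Rightarrow> int" where
  "circle_degree u = \<lfloor>Re (winding_number (\<lambda>t. Complex (u t $ 1) (u t $ 2)) 0)\<rfloor>"

definition degree_mod2 :: "(real \<Rightarrow> plane) \<Rightarrow> plane \<Rightarrow> int" where
  "degree_mod2 \<gamma> p = circle_degree (\<lambda>t. (\<gamma> t - p) /\<^sub>R norm (\<gamma> t - p)) mod 2"

definition filled_band :: "(real \<Rightarrow> plane) \<Rightarrow> (real \<Rightarrow> plane) \<Rightarrow> plane set" where
  "filled_band \<alpha> \<beta> =
     band_wall \<alpha> \<beta> \<union> {p. p \<notin> band_wall \<alpha> \<beta> \<and> degree_mod2 (band_loop \<alpha> \<beta>) p = 1}"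

definition endpoint_gap :: "(real \<Rightarrow> plane) \<Rightarrow> (real \<Rightarrow> plane) \<Rightarrow> real" where
  "endpoint_gap \<alpha> \<beta> = norm (\<alpha> 1 - \<beta> 1) + norm (\<alpha> 0 - \<beta> 0)"

definition optimal_pairs :: "curve \<Rightarrow> curve \<Rightarrow> ((real \<Rightarrow> plane) \<times> (real \<Rightarrow> plane)) set" where
  "optimal_pairs A B =
     {(\<alpha>, \<beta>) \<in> traversals A \<times> traversals B.
        \<forall>\<alpha>'\<in>traversals A. \<forall>\<beta>'\<in>traversals B. endpoint_gap \<alpha> \<beta> \<le> endpoint_gap \<alpha>' \<beta>'}"

definition fw_band :: "curve \<Rightarrow> curve \<Rightarrow> plane set" where
  "fw_band A B = closure (\<Union>(\<alpha>, \<beta>)\<in>optimal_pairs A B. filled_band \<alpha> \<beta>)"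

text \<open>A sample \<open>C_1, \<dots>, C_n\<close> is a function on \<open>nat\<close> of which only the values on \<open>{1..n}\<close> matter.\<close>

definition integral_depth ::
  "(curve \<Rightarrow> curve \<Rightarrow> plane set) \<Rightarrow> curve \<Rightarrow> nat \<Rightarrow> (nat \<Rightarrow> curve) \<Rightarrow> real" where
  "integral_depth R C n Cs =
     (\<Sum>(i, j)\<in>{(i, j). 1 \<le> i \<and> i < j \<and> j \<le> n}. arc_measure C (R (Cs i) (Cs j)))
       / real (n choose 2)"

definition infimal_depth ::
  "(curve \<Rightarrow> curve \<Rightarrow> plane set) \<Rightarrow> curve \<Rightarrow> nat \<Rightarrow> (nat \<Rightarrow> curve) \<Rightarrow> real" where
  "infimal_depth R C n Cs =
     (\<Sum>(i, j)\<in>{(i, j). 1 \<le> i \<and> i < j \<and> j \<le> n}.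
        if arc_measure C (R (Cs i) (Cs j)) = 1 then 1 else 0)
       / real (n choose 2)"

definition D_int :: "curve \<Rightarrow> nat \<Rightarrow> (nat \<Rightarrow> curve) \<Rightarrow> real" where
  "D_int = integral_depth global_band"

definition D_inf :: "curve \<Rightarrow> nat \<Rightarrow> (nat \<Rightarrow> curve) \<Rightarrow> real" where
  "D_inf = infimal_depth global_band"

definition D_FW :: "curve \<Rightarrow> nat \<Rightarrow> (nat \<Rightarrow> curve) \<Rightarrow> real" where
  "D_FW = integral_depth fw_band"

definition D_FW_inf :: "curve \<Rightarrow> nat \<Rightarrow> (nat \<Rightarrow> curve) \<Rightarrow> real" where
  "D_FW_inf = infimal_depth fw_band"

end

theory Submission
  imports Defs
begin

text \<open>
  Everything in a depth depends on a curve only through its constant-speed parametrizations, so it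
  suffices that these are transported by \<open>g\<close>. A similarity scales polygonal lengths by \<open>r\<close>, hence
  commutes with the passage to constant speed. The class \<open>g(C)\<close> may have a representative other
  than \<open>g \<circ> f\<close>, but equivalent parametrizations have the same constant-speed parametrization up to
  reversal (open curves) or up to shift and reversal (closed curves). Consequently the traversals of
  \<open>g(C)\<close> are the \<open>g\<close>-images of the traversals of \<open>C\<close>. Endpoint gaps are scaled by \<open>r\<close>, so optimal
  pairs correspond; degrees are multiplied by \<open>det Q\<close>, which is invisible mod 2; and arc measure is
  invariant because Lebesgue measure on the circle is invariant under shift and reversal.
\<close>

subsection \<open>Arc length\<close>

text \<open>Only the values on \<open>{0..1}\<close> are under control: a class contains functions
  that agree there and differ elsewhere, and the chosen representative of the image class may be any
  of them. So sets of traversals cannot be compared by equality. They are matched by a relation,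
  pointwise on \<open>{0..1}\<close> and total in both directions, and minimality, walls and degrees
  are carried across it. Continuity of arc length is the main analytic obligation, since strict
  monotonicity alone does not make arc length onto. From it come an inverse defined on the whole
  length interval, the continuity of that inverse, and hence the fact that traversals are paths, on
  which winding numbers and measurability of indicators rest. Likewise the bands are shown to be
  closed, so that their indicators along a path are integrable and the integral may be cut and
  shifted; without integrability a Bochner integral is the default value 0.\<close>

inductive polygonal :: "(real \<Rightarrow> plane) \<Rightarrow> real \<Rightarrow> real \<Rightarrow> real \<Rightarrow> bool" for f a where
  base: "polygonal f a a 0"
| step: "polygonal f a b S \<Longrightarrow> b < c \<Longrightarrow> polygonal f a c (S + norm (f c - f b))"

lemma polygonal_partition:
  assumes "\<tau> 0 = a" "\<And>j. j < J \<Longrightarrow> \<tau> j < \<tau> (Suc j)"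
  shows "polygonal f a (\<tau> J) (\<Sum>j<J. norm (f (\<tau> (Suc j)) - f (\<tau> j)))"
  using assms
proof (induction J)
  case 0
  then show ?case by (auto intro: base)
next
  case (Suc J)
  then show ?case by (auto intro!: step)
qed

lemma partition_polygonal:
  assumes "polygonal f a b S"
  shows "\<exists>J \<tau>. \<tau> 0 = a \<and> \<tau> J = b \<and> (\<forall>j<J. \<tau> j < \<tau> (Suc j)) \<and>
    S = (\<Sum>j<J. norm (f (\<tau> (Suc j)) - f (\<tau> j)))"
  using assms
proof induction
  case base
  then show ?case by (intro exI[of _ 0] exI[of _ "\<lambda>_. a"]) auto
next
  case (step b S c)
  then obtain J \<tau> where *: "\<tau> 0 = a" "\<tau> J = b" "\<forall>j<J. \<tau> j < \<tau> (Suc j)"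
    "S = (\<Sum>j<J. norm (f (\<tau> (Suc j)) - f (\<tau> j)))" by blast
  let ?\<tau> = "\<tau>(Suc J := c)"
  have "(\<Sum>j<J. norm (f (?\<tau> (Suc j)) - f (?\<tau> j))) = S"
    unfolding * by (rule sum.cong) auto
  with * \<open>b < c\<close> show ?case
    by (intro exI[of _ "Suc J"] exI[of _ ?\<tau>]) (auto simp: less_Suc_eq)
qed

text \<open>Trades indexed partitions for a predicate that grows by one point on the right, so that
  concatenating, transporting and splitting partitions become rule inductions.\<close>

lemma polygonal_lengths_eq: "polygonal_lengths f a b = {S. polygonal f a b S}"
proof (intro set_eqI iffI)
  fix S assume "S \<in> polygonal_lengths f a b"
  then obtain J \<tau> where "\<tau> 0 = a" "\<tau> J = b" "\<forall>j<J. \<tau> j < \<tau> (Suc j)"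
    "S = (\<Sum>j<J. norm (f (\<tau> (Suc j)) - f (\<tau> j)))"
    unfolding polygonal_lengths_def mem_Collect_eq by metis
  then show "S \<in> {S. polygonal f a b S}" using polygonal_partition[of \<tau> a J f] by simp
next
  fix S assume "S \<in> {S. polygonal f a b S}"
  then have "polygonal f a b S" by simp
  from partition_polygonal[OF this] show "S \<in> polygonal_lengths f a b"
    unfolding polygonal_lengths_def mem_Collect_eq by metis
qed

lemma polygonal_le: "polygonal f a b S \<Longrightarrow> a \<le> b"
  by (induction rule: polygonal.induct) auto

lemma polygonal_nonneg: "polygonal f a b S \<Longrightarrow> 0 \<le> S"
  by (induction rule: polygonal.induct) auto

lemma polygonal_refl: "polygonal f a a S \<Longrightarrow> S = 0"
  by (erule polygonal.cases) (auto dest: polygonal_le)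

lemma polygonal_single: "a < b \<Longrightarrow> polygonal f a b (norm (f b - f a))"
  using polygonal.step[OF polygonal.base] by force

lemma polygonal_exists: "a \<le> b \<Longrightarrow> \<exists>S. polygonal f a b S"
  by (metis order_le_less polygonal.base polygonal_single)

lemma polygonal_append: "polygonal f b c T \<Longrightarrow> polygonal f a b S \<Longrightarrow> polygonal f a c (S + T)"
proof (induction rule: polygonal.induct)
  case (step b' T c)
  then show ?case using polygonal.step[of f a b' "S + T" c] by (simp add: add.assoc)
qed simp

section \<open>Chord sums under reparametrization, reversal and scaling\<close>

text \<open>A strictly increasing \<open>h\<close> maps partition points to partition points with
  the same curve values, so the very same chord sum occurs. Surjectivity enters only when
  \<open>h\<close> is inverted for the converse.\<close>

lemma polygonal_mono_reparam:
  assumes "polygonal f a c S" "strict_mono_on {a..c} h" "\<And>t. t \<in> {a..c} \<Longrightarrow> f t = f' (h t)"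
  shows "polygonal f' (h a) (h c) S"
  using assms
proof (induction rule: polygonal.induct)
  case base
  show ?case by (rule polygonal.base)
next
  case (step b S c)
  then have "a \<le> b" using polygonal_le by blast
  with step have "polygonal f' (h a) (h b) S"
    by (intro step.IH) (auto simp: strict_mono_on_def)
  moreover have "h b < h c" using step \<open>a \<le> b\<close> by (auto simp: strict_mono_on_def)
  ultimately have "polygonal f' (h a) (h c) (S + norm (f' (h c) - f' (h b)))"
    by (rule polygonal.step)
  moreover have "f c = f' (h c)" "f b = f' (h b)" using step \<open>a \<le> b\<close> by auto
  ultimately show ?case by simp
qed

lemma polygonal_reverse:
  assumes "polygonal f a c S"
  shows "polygonal (\<lambda>t. f (d - t)) (d - c) (d - a) S"
  using assms
proof (induction rule: polygonal.induct)
  case (step b S c)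
  have "polygonal (\<lambda>t. f (d - t)) (d - c) (d - b) (norm (f c - f b))"
    using polygonal_single[of "d - c" "d - b" "\<lambda>t. f (d - t)"] step
    by (simp add: norm_minus_commute)
  from polygonal_append[OF step.IH this] show ?case by (simp add: add.commute)
qed (rule polygonal.base)

lemma path_length_eqI:
  assumes "polygonal_lengths f a b = polygonal_lengths f' a' b'"
  shows "path_length f a b = path_length f' a' b'"
  using assms by (simp add: path_length_def)

lemma polygonal_lengths_mono_reparam:
  assumes h: "strict_mono_on {a..b} h" "h ` {a..b} = {h a..h b}"
    and f: "\<And>t. t \<in> {a..b} \<Longrightarrow> f t = f' (h t)"
  shows "polygonal_lengths f a b = polygonal_lengths f' (h a) (h b)"
proof (cases "a \<le> b")
  case True
  have inj: "inj_on h {a..b}" using h(1) strict_mono_on_imp_inj_on by blast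
  \<comment> \<open>The inverse of \<open>h\<close> is again strictly increasing, so the one-sided
    transport can be applied in both directions.\<close>
  define k where "k = inv_into {a..b} h"
  have k: "k x \<in> {a..b}" "h (k x) = x" if "x \<in> {h a..h b}" for x
    using that h(2) by (auto simp: k_def inv_into_into f_inv_into_f simp del: atLeastAtMost_iff)
  have kh: "k (h t) = t" if "t \<in> {a..b}" for t
    using inj that by (simp add: k_def)
  have "strict_mono_on {h a..h b} k"
  proof (rule strict_mono_onI)
    fix x y assume xy: "x \<in> {h a..h b}" "y \<in> {h a..h b}" "x < y"
    show "k x < k y"
    proof (rule ccontr)
      assume "\<not> k x < k y"
      then have "h (k y) \<le> h (k x)"
        using h(1) k(1)[OF xy(1)] k(1)[OF xy(2)]
        by (metis not_less order_le_less strict_mono_onD)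
      then show False using xy k by auto
    qed
  qed
  moreover have "f' t = f (k t)" if "t \<in> {h a..h b}" for t using that k f by simp
  ultimately have "polygonal f a b S" if "polygonal f' (h a) (h b) S" for S
    using polygonal_mono_reparam[of f' "h a" "h b" S k f] that kh True by auto
  then show ?thesis using polygonal_mono_reparam[of f a b _ h f', OF _ h(1) f]
    by (auto simp: polygonal_lengths_eq)
next
  \<comment> \<open>The image of the empty interval is empty, so \<open>h a > h b\<close>, and there
    is no partition on either side.\<close>
  case False
  then have "\<not> h a \<le> h b" using h(2) by auto
  then show ?thesis using False by (auto simp: polygonal_lengths_eq dest: polygonal_le)
qed

lemma polygonal_lengths_reverse:
  "polygonal_lengths (\<lambda>t. f (d - t)) a b = polygonal_lengths f (d - b) (d - a)"
  using polygonal_reverse[of "\<lambda>t. f (d - t)" a b _ d] polygonal_reverse[of f "d - b" "d - a" _ d]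
  by (auto simp: polygonal_lengths_eq)

lemma polygonal_lengths_scale:
  assumes "\<And>x y. norm (g x - g y) = r * norm (x - y)"
  shows "polygonal_lengths (g \<circ> f) a b = (*) r ` polygonal_lengths f a b"
  unfolding polygonal_lengths_def
  by (auto simp: assms simp flip: sum_distrib_left)

lemma polygonal_lengths_nonempty: "a \<le> b \<Longrightarrow> polygonal_lengths f a b \<noteq> {}"
  using polygonal_exists by (auto simp: polygonal_lengths_eq)

section \<open>Finiteness and additivity of length\<close>

definition finite_length :: "(real \<Rightarrow> plane) \<Rightarrow> bool" where
  "finite_length f \<longleftrightarrow> bdd_above (polygonal_lengths f 0 1)"

text \<open>Any partition of the subinterval is padded by fixed partitions of \<open>{0..a}\<close>
  and \<open>{b..1}\<close>. The padding contributes nonnegative terms, so the bound for the whole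
  interval serves for the part.\<close>

lemma finite_length_subinterval:
  assumes "finite_length f" "0 \<le> a" "a \<le> b" "b \<le> 1"
  shows "bdd_above (polygonal_lengths f a b)"
proof -
  obtain M where M: "\<And>S. polygonal f 0 1 S \<Longrightarrow> S \<le> M"
    using assms(1) by (auto simp: finite_length_def polygonal_lengths_eq bdd_above_def)
  obtain S T where ST: "polygonal f 0 a S" "polygonal f b 1 T"
    using polygonal_exists assms by meson
  have "R \<le> M" if "polygonal f a b R" for R
    using M[OF polygonal_append[OF ST(2) polygonal_append[OF that ST(1)]]]
      polygonal_nonneg[OF ST(1)] polygonal_nonneg[OF ST(2)] by linarith
  then show ?thesis by (auto simp: polygonal_lengths_eq bdd_above_def)
qed

context
  fixes f :: "real \<Rightarrow> plane"
  assumes fin: "finite_length f"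
begin

lemma polygonal_le_path_length:
  assumes "polygonal f a b S" "0 \<le> a" "b \<le> 1"
  shows "S \<le> path_length f a b"
  unfolding path_length_def
  using finite_length_subinterval[OF fin, of a b] assms polygonal_le[OF assms(1)]
  by (auto intro!: cSup_upper simp: polygonal_lengths_eq)

lemma path_length_leI:
  assumes "a \<le> b" "\<And>S. polygonal f a b S \<Longrightarrow> S \<le> M"
  shows "path_length f a b \<le> M"
  unfolding path_length_def using polygonal_lengths_nonempty[OF assms(1)] assms(2)
  by (intro cSup_least) (auto simp: polygonal_lengths_eq)

lemma path_length_nonneg: "0 \<le> a \<Longrightarrow> a \<le> b \<Longrightarrow> b \<le> 1 \<Longrightarrow> 0 \<le> path_length f a b"
  using polygonal_exists polygonal_le_path_length polygonal_nonneg by (meson order_trans)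

lemma path_length_refl: "path_length f a a = 0"
proof -
  have "polygonal_lengths f a a = {0}"
    by (auto simp: polygonal_lengths_eq intro: polygonal.base dest: polygonal_refl)
  then show ?thesis by (simp add: path_length_def)
qed

lemma path_length_superadditive:
  assumes "0 \<le> a" "a \<le> b" "b \<le> c" "c \<le> 1"
  shows "path_length f a b + path_length f b c \<le> path_length f a c"
proof -
  \<comment> \<open>One supremum at a time: over the right piece with the left chord sum
    \<open>S\<close> fixed, and afterwards over \<open>S\<close>.\<close>
  have "path_length f b c \<le> path_length f a c - S" if "polygonal f a b S" for S
  proof (rule path_length_leI)
    fix T assume "polygonal f b c T"
    from polygonal_le_path_length[OF polygonal_append[OF this that]]
    show "T \<le> path_length f a c - S" using assms by simp
  qed (use assms in simp)
  then have "path_length f a b \<le> path_length f a c - path_length f b c"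
    by (intro path_length_leI) (use assms in \<open>force+\<close>)
  then show ?thesis by simp
qed

lemma norm_le_path_length:
  assumes "0 \<le> a" "a \<le> b" "b \<le> 1"
  shows "norm (f b - f a) \<le> path_length f a b"
proof (cases "a = b")
  case False
  then show ?thesis using assms by (intro polygonal_le_path_length polygonal_single) auto
qed (simp add: path_length_refl)

text \<open>Inserting \<open>b\<close> into a partition does not decrease its chord sum. The
  induction peels off the last chord, which lies to the right of \<open>b\<close> or has
  \<open>b\<close> after its left end.\<close>

lemma polygonal_le_split:
  assumes "polygonal f a c S" "0 \<le> a" "a \<le> b" "b \<le> c" "c \<le> 1"
  shows "S \<le> path_length f a b + path_length f b c"
  using assms
proof (induction rule: polygonal.induct)
  case base
  then show ?case using path_length_refl[of a] by auto
next
  case (step c' S c)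
  have ac': "a \<le> c'" using step polygonal_le by blast
  show ?case
  proof (cases "b \<le> c'")
    case True
    then have "S \<le> path_length f a b + path_length f b c'" using step by auto
    moreover have "path_length f b c' + path_length f c' c \<le> path_length f b c"
      using step True by (intro path_length_superadditive) auto
    moreover have "norm (f c - f c') \<le> path_length f c' c"
      using step ac' by (intro norm_le_path_length) auto
    ultimately show ?thesis by simp
  next
    \<comment> \<open>Here \<open>c' < b \<le> c\<close>: the last chord is broken at
      \<open>b\<close> by the triangle inequality, and its first half completes the left
      piece.\<close>
    case False
    have "S \<le> path_length f a c'"
      using step ac' by (intro polygonal_le_path_length) auto
    moreover have "path_length f a c' + path_length f c' b \<le> path_length f a b"
      using step False ac' by (intro path_length_superadditive) auto
    moreover have "norm (f b - f c') \<le> path_length f c' b"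
      using step False ac' by (intro norm_le_path_length) auto
    moreover have "norm (f c - f b) \<le> path_length f b c"
      using step by (intro norm_le_path_length) auto
    moreover have "norm (f c - f c') \<le> norm (f c - f b) + norm (f b - f c')"
      using norm_triangle_ineq[of "f c - f b" "f b - f c'"] by simp
    ultimately show ?thesis by simp
  qed
qed

lemma path_length_additive:
  assumes "0 \<le> a" "a \<le> b" "b \<le> c" "c \<le> 1"
  shows "path_length f a c = path_length f a b + path_length f b c"
proof (rule antisym)
  show "path_length f a c \<le> path_length f a b + path_length f b c"
    by (rule path_length_leI) (use assms polygonal_le_split in auto)
qed (rule path_length_superadditive[OF assms])

text \<open>Arc length is lower semicontinuous, being a supremum of functions of the endpoint that are
  continuous; together with monotonicity this is continuity from the left.\<close>

lemma path_length_left_continuous: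
  assumes "continuous_on {0..1} f" "0 < b" "b \<le> 1" "0 < e"
  shows "\<exists>d>0. \<forall>x\<in>{0..b}. b - d < x \<longrightarrow> path_length f x b < e"
proof -
  have "\<exists>S. polygonal f 0 b S \<and> path_length f 0 b - e / 2 < S"
    using assms less_cSupE[of "path_length f 0 b - e / 2" "polygonal_lengths f 0 b"]
      polygonal_lengths_nonempty[of 0 b f]
    by (auto simp: path_length_def polygonal_lengths_eq)
  then obtain S where S: "polygonal f 0 b S" "path_length f 0 b - e / 2 < S" by blast
  \<comment> \<open>A near-optimal partition is kept except for its last chord. Ending that chord at
    \<open>x\<close> in \<open>{b'<..b}\<close> instead of \<open>b\<close> loses less than
    \<open>e / 2\<close> near \<open>b\<close>, and \<open>S\<close> itself misses the supremum by
    less than \<open>e / 2\<close>. As \<open>0 < b\<close>, a last chord exists.\<close>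
  from S(1) obtain b' S' where S': "polygonal f 0 b' S'" "b' < b" "S = S' + norm (f b - f b')"
    by (cases rule: polygonal.cases) (use assms in auto)
  have "0 \<le> b'" using S' polygonal_le by blast
  have "b \<in> {0..1}" using assms by simp
  then obtain d where d: "d > 0" "\<forall>x\<in>{0..1}. dist x b < d \<longrightarrow> dist (f x) (f b) < e / 2"
    using assms unfolding continuous_on_iff by (meson half_gt_zero)
  have "path_length f x b < e" if x: "x \<in> {0..b}" "b - min d (b - b') < x" for x
  proof -
    have xb': "b' < x" using x by simp
    have "dist x b < d" using x by (auto simp: dist_real_def)
    then have "dist (f x) (f b) < e / 2" using d x assms by auto
    then have "norm (f b - f b') < norm (f x - f b') + e / 2"
      using norm_triangle_ineq[of "f b - f x" "f x - f b'"] by (simp add: dist_norm norm_minus_commute)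
    moreover have "S' + norm (f x - f b') \<le> path_length f 0 x"
      using x assms by (intro polygonal_le_path_length polygonal.step[OF S'(1) xb']) auto
    moreover have "path_length f 0 b = path_length f 0 x + path_length f x b"
      using x assms by (intro path_length_additive) auto
    ultimately show ?thesis using S S' by linarith
  qed
  then show ?thesis using d(1) S'(2) by (intro exI[of _ "min d (b - b')"]) auto
qed

end

section \<open>Reversal and continuity of arc length\<close>

lemma finite_length_reverse: "finite_length (\<lambda>t. f (1 - t)) \<longleftrightarrow> finite_length f"
  by (simp add: finite_length_def polygonal_lengths_reverse)

lemma path_length_reverse: "path_length (\<lambda>t. f (d - t)) a b = path_length f (d - b) (d - a)"
  by (simp add: path_length_def polygonal_lengths_reverse)

text \<open>Reversal preserves lengths and turns right neighbourhoods of \<open>a\<close> into left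
  neighbourhoods of \<open>1 - a\<close>.\<close>

lemma path_length_right_continuous:
  assumes fin: "finite_length f" and "continuous_on {0..1} f" "0 \<le> a" "a < 1" "0 < e"
  shows "\<exists>d>0. \<forall>x\<in>{a..1}. x < a + d \<longrightarrow> path_length f a x < e"
proof -
  have "continuous_on {0..1} (\<lambda>t. f (1 - t))"
    by (rule continuous_on_compose2[OF assms(2)]) (auto intro!: continuous_intros)
  then obtain d where d: "d > 0"
    "\<forall>x\<in>{0..1 - a}. 1 - a - d < x \<longrightarrow> path_length (\<lambda>t. f (1 - t)) x (1 - a) < e"
    using path_length_left_continuous[of "\<lambda>t. f (1 - t)" "1 - a" e] assms
    by (auto simp: finite_length_reverse)
  have "path_length f a x < e" if "x \<in> {a..1}" "x < a + d" for x
    using d(2)[rule_format, of "1 - x"] that assms by (auto simp: path_length_reverse)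
  then show ?thesis using d(1) by blast
qed

text \<open>By additivity an increment of arc length is the length of the piece in between, so the
  two one-sided estimates combine. At an end of \<open>{0..1}\<close> one of them concerns a single
  point, which has length 0.\<close>

lemma continuous_on_arc_length_map:
  assumes fin: "finite_length f" and cont: "continuous_on {0..1} f"
  shows "continuous_on {0..1} (arc_length_map f)"
  unfolding continuous_on_iff
proof (intro ballI allI impI)
  fix x e :: real assume x: "x \<in> {0..1}" and e: "0 < e"
  have l: "\<exists>d>0. \<forall>y\<in>{0..x}. x - d < y \<longrightarrow> path_length f y x < e"
  proof (cases "x = 0")
    case True
    then show ?thesis using e by (intro exI[of _ 1]) (auto simp: path_length_refl[OF fin])
  qed (use path_length_left_continuous[OF fin cont] x e in auto)
  have r: "\<exists>d>0. \<forall>y\<in>{x..1}. y < x + d \<longrightarrow> path_length f x y < e"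
  proof (cases "x = 1")
    case True
    then show ?thesis using e by (intro exI[of _ 1]) (auto simp: path_length_refl[OF fin])
  qed (use path_length_right_continuous[OF fin cont] x e in auto)
  from l obtain d1 where d1: "d1 > 0" "\<forall>y\<in>{0..x}. x - d1 < y \<longrightarrow> path_length f y x < e" by blast
  from r obtain d2 where d2: "d2 > 0" "\<forall>y\<in>{x..1}. y < x + d2 \<longrightarrow> path_length f x y < e" by blast
  have "dist (arc_length_map f y) (arc_length_map f x) < e"
    if y: "y \<in> {0..1}" "dist y x < min d1 d2" for y
  proof (cases "y \<le> x")
    case True
    then have "path_length f y x < e" using d1 y by (auto simp: dist_real_def)
    moreover have "path_length f 0 x = path_length f 0 y + path_length f y x"
      using x y True by (intro path_length_additive[OF fin]) auto
    moreover have "0 \<le> path_length f y x" using x y True by (intro path_length_nonneg[OF fin]) auto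
    ultimately show ?thesis by (simp add: arc_length_map_def dist_real_def)
  next
    case False
    then have "path_length f x y < e" using d2 y by (auto simp: dist_real_def)
    moreover have "path_length f 0 y = path_length f 0 x + path_length f x y"
      using x y False by (intro path_length_additive[OF fin]) auto
    moreover have "0 \<le> path_length f x y" using x y False by (intro path_length_nonneg[OF fin]) auto
    ultimately show ?thesis by (simp add: arc_length_map_def dist_real_def)
  qed
  then show "\<exists>d>0. \<forall>y\<in>{0..1}. dist y x < d \<longrightarrow> dist (arc_length_map f y) (arc_length_map f x) < e"
    using d1(1) d2(1) by (intro exI[of _ "min d1 d2"]) auto
qed

lemma param_curvesD:
  assumes "f \<in> param_curves"
  shows "continuous_on {0..1} f" "finite_length f" "strict_mono_on {0..1} (arc_length_map f)"
  using assms by (auto simp: param_curves_def finite_length_def)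

lemma arc_length_map_ends:
  assumes "finite_length f"
  shows "arc_length_map f 0 = 0" "arc_length_map f 1 = path_length f 0 1"
  using assms by (simp_all add: arc_length_map_def path_length_refl)

lemma path_length_pos:
  assumes "f \<in> param_curves"
  shows "0 < path_length f 0 1"
  using strict_mono_onD[OF param_curvesD(3)[OF assms], of 0 1]
    arc_length_map_ends[OF param_curvesD(2)[OF assms]] by simp

text \<open>The intermediate value theorem makes arc length onto, so that
  \<open>the_inv_into\<close> is meaningful at every length between 0 and the total.\<close>

lemma arc_length_map_image:
  assumes "f \<in> param_curves"
  shows "arc_length_map f ` {0..1} = {0..path_length f 0 1}"
proof -
  note fD = param_curvesD[OF assms]
  have mono: "mono_on {0..1} (arc_length_map f)"
    using fD(3) strict_mono_on_imp_mono_on by blast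
  have "arc_length_map f ` {0..1} \<subseteq> {arc_length_map f 0..arc_length_map f 1}"
    by (auto intro!: mono_onD[OF mono])
  moreover have "{arc_length_map f 0..arc_length_map f 1} \<subseteq> arc_length_map f ` {0..1}"
  proof
    fix y assume "y \<in> {arc_length_map f 0..arc_length_map f 1}"
    then obtain x where "0 \<le> x" "x \<le> 1" "arc_length_map f x = y"
      using IVT'[of "arc_length_map f" 0 y 1] continuous_on_arc_length_map[OF fD(2,1)] by auto
    then show "y \<in> arc_length_map f ` {0..1}" by auto
  qed
  ultimately show ?thesis by (simp add: arc_length_map_ends[OF fD(2)])
qed

subsection \<open>Constant-speed parametrizations\<close>

text \<open>The formula behind \<open>unit_rep\<close> for an arbitrary parametrization, so that
  equivalent parametrizations can be compared before any representative is chosen.\<close>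

definition unit_speed :: "(real \<Rightarrow> plane) \<Rightarrow> real \<Rightarrow> plane" where
  "unit_speed f t = f (the_inv_into {0..1} (arc_length_map f) (path_length f 0 1 * t))"

lemma unit_rep_unit_speed: "unit_rep C = unit_speed (representative C)"
  by (simp add: fun_eq_iff unit_rep_def arc_rep_def curve_length_def unit_speed_def)

lemma unit_speed_arc_length:
  assumes "f \<in> param_curves" "t \<in> {0..1}"
  shows "unit_speed f (arc_length_map f t / path_length f 0 1) = f t"
  using path_length_pos[OF assms(1)] assms
    the_inv_into_f_f[OF strict_mono_on_imp_inj_on[OF param_curvesD(3)[OF assms(1)]]]
  by (simp add: unit_speed_def)

text \<open>Together with \<open>unit_speed_arc_length\<close> this determines
  \<open>unit_speed f\<close> on \<open>{0..1}\<close> without mentioning the inverse: a parameter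
  is replaced by the length fraction of some \<open>t\<close>.\<close>

lemma arc_length_parameter:
  assumes "f \<in> param_curves" "x \<in> {0..1}"
  obtains t where "t \<in> {0..1}" "x = arc_length_map f t / path_length f 0 1"
proof -
  have "path_length f 0 1 * x \<in> {0..path_length f 0 1}"
    using path_length_pos[OF assms(1)] assms(2) by (auto simp: mult_le_cancel_left1)
  then obtain t where "t \<in> {0..1}" "path_length f 0 1 * x = arc_length_map f t"
    using arc_length_map_image[OF assms(1)] by (metis imageE)
  with path_length_pos[OF assms(1)] that show thesis by (simp add: field_simps)
qed

lemma arc_length_fraction:
  assumes "f \<in> param_curves" "t \<in> {0..1}"
  shows "arc_length_map f t / path_length f 0 1 \<in> {0..1}"
proof -
  have "arc_length_map f t \<in> {0..path_length f 0 1}"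
    using arc_length_map_image[OF assms(1)] assms(2) by blast
  then show ?thesis using path_length_pos[OF assms(1)] by simp
qed

lemma unit_speed_ends:
  assumes "f \<in> param_curves"
  shows "unit_speed f 0 = f 0" "unit_speed f 1 = f 1"
  using unit_speed_arc_length[OF assms, of 0] unit_speed_arc_length[OF assms, of 1]
    path_length_pos[OF assms] arc_length_map_ends[OF param_curvesD(2)[OF assms]] by simp_all

lemma unit_speed_image:
  assumes "f \<in> param_curves"
  shows "unit_speed f ` {0..1} = f ` {0..1}"
proof
  show "unit_speed f ` {0..1} \<subseteq> f ` {0..1}"
    using arc_length_parameter[OF assms] unit_speed_arc_length[OF assms]
    by (metis (no_types, lifting) image_eqI image_subsetI)
  show "f ` {0..1} \<subseteq> unit_speed f ` {0..1}"
    using arc_length_fraction[OF assms] unit_speed_arc_length[OF assms]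
    by (metis (no_types, lifting) image_eqI image_subsetI)
qed

text \<open>A continuous injection of a compact interval has a continuous inverse.\<close>

lemma continuous_on_unit_speed:
  assumes "f \<in> param_curves"
  shows "continuous_on {0..1} (unit_speed f)"
proof -
  note fD = param_curvesD[OF assms]
  let ?k = "the_inv_into {0..1} (arc_length_map f)"
  have inj: "inj_on (arc_length_map f) {0..1}" using fD(3) strict_mono_on_imp_inj_on by blast
  have "continuous_on {0..path_length f 0 1} ?k"
    using continuous_on_inv[OF continuous_on_arc_length_map[OF fD(2,1)], of ?k]
      the_inv_into_f_f[OF inj] arc_length_map_image[OF assms] by simp
  then have "continuous_on {0..1} (\<lambda>t. ?k (path_length f 0 1 * t))"
    by (rule continuous_on_compose2)
      (use path_length_pos[OF assms] in \<open>auto intro!: continuous_intros simp: mult_le_cancel_left1\<close>)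
  moreover have "?k (path_length f 0 1 * t) \<in> {0..1}" if "t \<in> {0..1}" for t
    using the_inv_into_into[OF inj _ subset_refl] arc_length_map_image[OF assms]
      path_length_pos[OF assms] that by (auto simp: mult_le_cancel_left1)
  ultimately have "continuous_on {0..1} (\<lambda>t. f (?k (path_length f 0 1 * t)))"
    by (rule continuous_on_compose2[OF fD(1), rotated, OF image_subsetI, rotated])
  then show ?thesis by (simp add: unit_speed_def[abs_def])
qed

section \<open>Equivalent parametrizations of open curves\<close>

text \<open>Arc length along the reversed curve is the total minus the arc length from the other
  end, so length fractions become complementary.\<close>

lemma param_curves_reverse:
  assumes "f \<in> param_curves"
  shows "(\<lambda>t. f (1 - t)) \<in> param_curves"
    and "t \<in> {0..1} \<Longrightarrow> unit_speed (\<lambda>t. f (1 - t)) t = unit_speed f (1 - t)"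
proof -
  let ?r = "\<lambda>t. f (1 - t)"
  note fD = param_curvesD[OF assms]
  have s: "arc_length_map ?r t = path_length f 0 1 - arc_length_map f (1 - t)" if "t \<in> {0..1}" for t
    using path_length_additive[OF fD(2), of 0 "1 - t" 1] that
    by (simp add: arc_length_map_def path_length_reverse)
  have L: "path_length ?r 0 1 = path_length f 0 1" by (simp add: path_length_reverse)
  have "strict_mono_on {0..1} (arc_length_map ?r)"
    using fD(3) by (auto simp: strict_mono_on_def s)
  moreover have "continuous_on {0..1} ?r"
    by (rule continuous_on_compose2[OF fD(1)]) (auto intro!: continuous_intros)
  moreover have "finite_length ?r" using fD(2) finite_length_reverse by blast
  ultimately show r: "?r \<in> param_curves" by (auto simp: param_curves_def finite_length_def)
  assume "t \<in> {0..1}"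
  then obtain x where x: "x \<in> {0..1}" "t = arc_length_map ?r x / path_length ?r 0 1"
    using arc_length_parameter[OF r] by metis
  then have "1 - t = arc_length_map f (1 - x) / path_length f 0 1"
    using path_length_pos[OF assms] s L by (simp add: field_simps)
  then show "unit_speed ?r t = unit_speed f (1 - t)"
    using unit_speed_arc_length[OF r x(1)] unit_speed_arc_length[OF assms, of "1 - x"] x by simp
qed

lemma strict_mono_on_image_subinterval:
  fixes h :: "real \<Rightarrow> real"
  assumes "strict_mono_on {a..b} h" "h ` {a..b} = {h a..h b}" "a \<le> c" "c \<le> d" "d \<le> b"
  shows "h ` {c..d} = {h c..h d}"
proof
  have mono: "mono_on {a..b} h" using assms(1) strict_mono_on_imp_mono_on by blast
  show "h ` {c..d} \<subseteq> {h c..h d}" using assms(3-5) by (auto intro!: mono_onD[OF mono])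
  show "{h c..h d} \<subseteq> h ` {c..d}"
  proof
    fix y assume y: "y \<in> {h c..h d}"
    have "h a \<le> h c" "h d \<le> h b"
      using mono_onD[OF mono, of a c] mono_onD[OF mono, of d b] assms by simp_all
    then have "y \<in> h ` {a..b}" using y assms(2) by auto
    then obtain x where x: "x \<in> {a..b}" "y = h x" by auto
    have "\<not> x < c" using strict_mono_onD[OF assms(1), of x c] x y assms by auto
    moreover have "\<not> d < x" using strict_mono_onD[OF assms(1), of d x] x y assms by auto
    ultimately show "y \<in> h ` {c..d}" using x by auto
  qed
qed

lemma path_length_mono_reparam:
  fixes h :: "real \<Rightarrow> real"
  assumes h: "strict_mono_on {a..b} h" "h ` {a..b} = {h a..h b}" and cd: "a \<le> c" "c \<le> d" "d \<le> b"
    and f: "\<And>t. t \<in> {c..d} \<Longrightarrow> f t = f' (h t)"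
  shows "path_length f c d = path_length f' (h c) (h d)"
proof (rule path_length_eqI, rule polygonal_lengths_mono_reparam)
  show "strict_mono_on {c..d} h" using h(1) cd by (auto simp: strict_mono_on_def)
qed (use strict_mono_on_image_subinterval[OF h cd] f in auto)

lemma strict_mono_on_image_ends:
  fixes h :: "real \<Rightarrow> real"
  assumes "strict_mono_on {a..b} h" "h ` {a..b} = {c..d}" "a \<le> b"
  shows "h a = c" "h b = d"
proof -
  have mono: "mono_on {a..b} h" using assms(1) strict_mono_on_imp_mono_on by blast
  have im: "h a \<in> {c..d}" "h b \<in> {c..d}" using assms(2,3) by auto
  then have "c \<in> h ` {a..b}" "d \<in> h ` {a..b}" using assms(2) by auto
  then obtain x y where xy: "x \<in> {a..b}" "c = h x" "y \<in> {a..b}" "d = h y" by auto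
  have "h a \<le> c" using mono_onD[OF mono, of a x] xy assms(3) by simp
  moreover have "d \<le> h b" using mono_onD[OF mono, of y b] xy assms(3) by simp
  ultimately show "h a = c" "h b = d" using im by auto
qed

text \<open>The points \<open>t\<close> and \<open>h t\<close> have the same arc length on their
  respective curves, and the total lengths agree; hence the same fraction \<open>x\<close> belongs
  to both.\<close>

lemma unit_speed_reparam:
  assumes f: "f1 \<in> param_curves" "f2 \<in> param_curves"
    and h: "strict_mono_on {0..1} h" "h ` {0..1} = {0..1}"
    and eq: "\<And>t. t \<in> {0..1} \<Longrightarrow> f1 t = f2 (h t)"
    and x: "x \<in> {0..1}"
  shows "unit_speed f1 x = unit_speed f2 x"
proof -
  have h01: "h 0 = 0" "h 1 = 1" using strict_mono_on_image_ends[OF h] by auto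
  have s: "path_length f1 0 t = path_length f2 0 (h t)" if "t \<in> {0..1}" for t
    using path_length_mono_reparam[of 0 1 h 0 t f1 f2] h h01 eq that by simp
  obtain t where t: "t \<in> {0..1}" "x = arc_length_map f1 t / path_length f1 0 1"
    using arc_length_parameter[OF f(1) x] by metis
  then have "x = arc_length_map f2 (h t) / path_length f2 0 1"
    using s[of t] s[of 1] h01 by (simp add: arc_length_map_def)
  moreover have "h t \<in> {0..1}" using h(2) t(1) by blast
  ultimately show ?thesis using unit_speed_arc_length[OF f(1) t(1)] unit_speed_arc_length[OF f(2)]
      eq[OF t(1)] t(2) by metis
qed

lemma open_rel_unit_speed:
  assumes "(f1, f2) \<in> open_rel"
  shows "(\<forall>t\<in>{0..1}. unit_speed f1 t = unit_speed f2 t) \<or>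
    (\<forall>t\<in>{0..1}. unit_speed f1 t = unit_speed f2 (1 - t))"
proof -
  obtain \<phi> \<psi> where f: "f1 \<in> param_curves" "f2 \<in> param_curves"
    and \<phi>: "homeomorphism {0..1} {0..1} \<phi> \<psi>" and eq: "\<And>t. t \<in> {0..1} \<Longrightarrow> f1 t = f2 (\<phi> t)"
    using assms by (auto simp: open_rel_def)
  have "inj_on \<phi> {0..1}" using \<phi> by (metis homeomorphism_apply1 inj_on_inverseI)
  then consider "strict_mono_on {0..1} \<phi>" | "strict_antimono_on {0..1} \<phi>"
    using injective_eq_monotone_map[of "{0..1}" \<phi>] homeomorphism_cont1[OF \<phi>]
    by (auto simp: is_interval_cc)
  then show ?thesis
  proof cases
    case 1
    then show ?thesis using unit_speed_reparam[OF f 1] homeomorphism_image1[OF \<phi>] eq by auto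
  next
    case 2
    \<comment> \<open>A decreasing homeomorphism becomes increasing after a flip of the parameter,
      which is charged to \<open>f1\<close> and then undone by
      \<open>param_curves_reverse\<close>.\<close>
    let ?h = "\<lambda>t. \<phi> (1 - t)"
    have "strict_mono_on {0..1} ?h" using 2 by (auto simp: monotone_on_def)
    moreover have "?h ` {0..1} = {0..1}"
    proof -
      have "(\<lambda>t. 1 - t) ` {0..1} = {0..1::real}"
        by (simp add: image_diff_atLeastAtMost)
      then show ?thesis using homeomorphism_image1[OF \<phi>] by (metis image_image)
    qed
    ultimately have "unit_speed (\<lambda>t. f1 (1 - t)) x = unit_speed f2 x" if "x \<in> {0..1}" for x
      using unit_speed_reparam[OF param_curves_reverse(1)[OF f(1)] f(2), of ?h] eq that by auto
    then have "unit_speed f1 t = unit_speed f2 (1 - t)" if "t \<in> {0..1}" for t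
      using param_curves_reverse(2)[OF f(1), of "1 - t"] that by auto
    then show ?thesis by blast
  qed
qed

section \<open>Equivalent parametrizations of closed curves\<close>

text \<open>Here \<open>h\<close> is a lift of a circle map, running through one full turn from
  \<open>u0\<close>. Where \<open>h t = 1\<close> both equations apply, which encodes that
  \<open>f2\<close> closes up. The shift is the fraction of the length of \<open>f2\<close> that
  precedes \<open>u0\<close>.\<close>

lemma unit_speed_shift_reparam:
  assumes f: "f1 \<in> param_curves" "f2 \<in> param_curves" and u0: "u0 \<in> {0..<1}"
    and h: "strict_mono_on {0..1} h" "h ` {0..1} = {u0..u0 + 1}"
    and eq1: "\<And>t. t \<in> {0..1} \<Longrightarrow> h t \<le> 1 \<Longrightarrow> f1 t = f2 (h t)"
    and eq2: "\<And>t. t \<in> {0..1} \<Longrightarrow> h t \<ge> 1 \<Longrightarrow> f1 t = f2 (h t - 1)"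
  shows "\<exists>\<theta>\<in>{0..<1}. \<forall>t\<in>{0..1}. unit_speed f1 t = unit_speed f2 (frac (t + \<theta>))"
proof -
  note fin = param_curvesD(2)[OF f(1)] param_curvesD(2)[OF f(2)]
  have h01: "h 0 = u0" "h 1 = u0 + 1" using strict_mono_on_image_ends[OF h] by auto
  have "1 \<in> h ` {0..1}" using h(2) u0 by auto
  \<comment> \<open>The parameter at which the lift passes the basepoint of \<open>f2\<close>; arc
    length is computed separately on each side of it.\<close>
  then obtain c where c: "c \<in> {0..1}" "h c = 1" by auto
  have le: "h s \<le> h t" if "s \<in> {0..1}" "t \<in> {0..1}" "s \<le> t" for s t
    using mono_onD[OF strict_mono_on_imp_mono_on[OF h(1)]] that by blast
  let ?s1 = "arc_length_map f1" and ?s2 = "arc_length_map f2"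
  have L2: "?s2 1 = path_length f2 0 1" using arc_length_map_ends[OF fin(2)] by simp
  have s1: "?s1 t = ?s2 (h t) - ?s2 u0" if t: "t \<in> {0..c}" for t
  proof -
    have "h s \<le> 1" if "s \<in> {0..t}" for s using le[of s c] that t c by auto
    then have "path_length f1 0 t = path_length f2 u0 (h t)"
      using path_length_mono_reparam[OF h(1), of 0 t f1 f2] h h01 t c eq1 by auto
    moreover have "u0 \<le> h t" "h t \<le> 1" using h01 c t le[of 0 t] le[of t c] by auto
    ultimately show ?thesis using path_length_additive[OF fin(2), of 0 u0 "h t"] u0
      by (simp add: arc_length_map_def)
  qed
  \<comment> \<open>Up to \<open>c\<close> the curve has used the length of \<open>f2\<close> from
    \<open>u0\<close> to its end; from there on \<open>f2\<close> is run again from its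
    start.\<close>
  have s2: "?s1 t = ?s2 1 - ?s2 u0 + ?s2 (h t - 1)" if t: "t \<in> {c..1}" for t
  proof -
    have "strict_mono_on {0..1} (\<lambda>t. h t - 1)" using h(1) by (auto simp: strict_mono_on_def)
    moreover have "(\<lambda>t. h t - 1) ` {0..1} = {h 0 - 1..h 1 - 1}"
    proof -
      have "(\<lambda>t. h t - 1) ` {0..1} = (\<lambda>x. x - 1) ` (h ` {0..1})" by (simp add: image_image)
      then show ?thesis using h(2) h01 by simp
    qed
    moreover have "h s \<ge> 1" if "s \<in> {c..t}" for s using le[of c s] that t c by auto
    ultimately have "path_length f1 c t = path_length f2 0 (h t - 1)"
      using path_length_mono_reparam[of 0 1 "\<lambda>t. h t - 1" c t f1 f2] t c eq2 by auto
    moreover have "path_length f1 0 t = path_length f1 0 c + path_length f1 c t"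
      using t c by (intro path_length_additive[OF fin(1)]) auto
    ultimately show ?thesis using s1[of c] c by (simp add: arc_length_map_def)
  qed
  have L: "path_length f1 0 1 = path_length f2 0 1"
    using s2[of 1] c h01 L2 arc_length_map_ends[OF fin(1)] by simp
  let ?L = "path_length f2 0 1"
  define \<theta> where "\<theta> = ?s2 u0 / ?L"
  have Lpos: "?L > 0" using path_length_pos[OF f(2)] .
  have u0': "u0 \<in> {0..1}" using u0 by auto
  \<comment> \<open>Strictness keeps length fractions inside \<open>{0..<1}\<close>, where
    \<open>frac\<close> is the identity.\<close>
  have frac_lt: "?s2 t / ?L < 1" if "t \<in> {0..<1}" for t
    using strict_mono_onD[OF param_curvesD(3)[OF f(2)], of t 1] that Lpos L2 by auto
  have \<theta>: "\<theta> \<in> {0..<1}"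
    using arc_length_fraction[OF f(2) u0'] frac_lt[OF u0] by (simp add: \<theta>_def)
  have "unit_speed f1 x = unit_speed f2 (frac (x + \<theta>))" if x: "x \<in> {0..1}" for x
  proof -
    obtain t where t: "t \<in> {0..1}" "x = ?s1 t / ?L"
      using arc_length_parameter[OF f(1) x] L by metis
    have f1t: "unit_speed f1 x = f1 t" using unit_speed_arc_length[OF f(1) t(1)] t(2) L by simp
    show ?thesis
    proof (cases "t < c")
      case True
      then have "h t < 1" "0 \<le> h t"
        using strict_mono_onD[OF h(1), of t c] c t le[of 0 t] h01 u0 by auto
      moreover have "x + \<theta> = ?s2 (h t) / ?L"
        using s1[of t] t True by (simp add: \<theta>_def add_divide_distrib[symmetric])
      moreover have "?s2 (h t) / ?L \<in> {0..<1}"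
        using frac_lt[of "h t"] arc_length_fraction[OF f(2), of "h t"] calculation by auto
      ultimately have "unit_speed f2 (frac (x + \<theta>)) = f2 (h t)"
        using unit_speed_arc_length[OF f(2), of "h t"] by simp
      then show ?thesis using f1t eq1[OF t(1)] \<open>h t < 1\<close> by simp
    next
      case False
      then have ht: "1 \<le> h t" "h t - 1 < 1" "h t - 1 \<in> {0..<1}"
        using le[of c t] le[of t 1] c t h01 u0 by auto
      have "x + \<theta> = ?s2 (h t - 1) / ?L + 1"
        using s2[of t] t False Lpos L2 by (simp add: \<theta>_def field_simps)
      moreover have "?s2 (h t - 1) / ?L \<in> {0..<1}"
        using frac_lt[of "h t - 1"] arc_length_fraction[OF f(2), of "h t - 1"] ht by auto
      ultimately have "unit_speed f2 (frac (x + \<theta>)) = f2 (h t - 1)"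
        using unit_speed_arc_length[OF f(2), of "h t - 1"] ht by (simp add: frac_1_eq)
      then show ?thesis using f1t eq2[OF t(1)] ht by simp
    qed
  qed
  then show ?thesis using \<theta> by blast
qed

lemma cis_2pi_eq_iff: "cis (2 * pi * x) = cis (2 * pi * y) \<longleftrightarrow> x - y \<in> \<int>"
proof -
  have "\<i> * of_real (2 * pi * x) = \<i> * of_real (2 * pi * y) + of_real (of_int (2 * n) * pi) * \<i> \<longleftrightarrow>
      x = y + of_int n" for n
  proof -
    have "\<i> * of_real (2 * pi * x) = \<i> * of_real (2 * pi * y) + of_real (of_int (2 * n) * pi) * \<i> \<longleftrightarrow>
        (2 * pi) * x = (2 * pi) * (y + of_int n)"
      by (simp add: complex_eq_iff algebra_simps)
    then show ?thesis by simp
  qed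
  then have "cis (2 * pi * x) = cis (2 * pi * y) \<longleftrightarrow> (\<exists>n::int. x = y + of_int n)"
    unfolding cis_conv_exp exp_eq by simp
  also have "\<dots> \<longleftrightarrow> x - y \<in> \<int>"
    by (auto simp: Ints_def algebra_simps)
  finally show ?thesis .
qed

lemma cis_Arg2pi: "norm z = 1 \<Longrightarrow> cis (Arg2pi z) = z"
  using Arg2pi_eq[of z] by (simp add: cis_conv_exp)

lemma Ints_abs_lt_1:
  fixes x :: real
  assumes "x \<in> \<int>" "-1 < x" "x < 1"
  shows "x = 0"
  using assms by (auto elim!: Ints_cases)

text \<open>A lift is first obtained off the basepoint only. The image being the open interval, the
  values \<open>u\<close> and \<open>u + 1\<close> can be filled in at the ends without losing
  strictness.\<close>

lemma strict_mono_on_extend_ends: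
  fixes k :: "real \<Rightarrow> real"
  assumes k: "strict_mono_on {0<..<1} k" "k ` {0<..<1} = {u<..<u + 1}"
  obtains h where "strict_mono_on {0..1} h" "h ` {0..1} = {u..u + 1}" "h 0 = u" "h 1 = u + 1"
    "\<And>t. t \<in> {0<..<1} \<Longrightarrow> h t = k t"
proof
  define h where "h t = (if t \<le> 0 then u else if t \<ge> 1 then u + 1 else k t)" for t
  have kim: "k t \<in> {u<..<u + 1}" if "0 < t" "t < 1" for t
    using k(2) that by (metis greaterThanLessThan_iff image_eqI)
  show "strict_mono_on {0..1} h"
    using kim strict_mono_onD[OF k(1)] by (auto simp: strict_mono_on_def h_def)
  have "{0..1} = {0<..<1} \<union> {0, 1::real}" by auto
  then have "h ` {0..1} = h ` {0<..<1} \<union> {u, u + 1}" by (auto simp: h_def)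
  also have "h ` {0<..<1} = k ` {0<..<1}" by (intro image_cong) (auto simp: h_def)
  finally show "h ` {0..1} = {u..u + 1}" using k(2) by auto
  show "h 0 = u" "h 1 = u + 1" "\<And>t. t \<in> {0<..<1} \<Longrightarrow> h t = k t" by (auto simp: h_def)
qed

text \<open>A self-homeomorphism of the circle lifts to a monotone bijection between fundamental domains.
  Off the basepoint the lift is \<^term>\<open>Arg2pi\<close> of the image, normalized by the image of the
  basepoint, and an injective continuous map on an interval is monotone.\<close>

lemma circle_homeomorphism_lift:
  assumes \<phi>: "homeomorphism (sphere (0::complex) 1) (sphere 0 1) \<phi> \<psi>"
  shows "\<exists>u\<in>{0..<1}. \<exists>h. strict_mono_on {0..1} h \<and> h ` {0..1} = {u..u + 1} \<and>
    ((\<forall>t\<in>{0..1}. cis (2 * pi * h t) = \<phi> (cis (2 * pi * t))) \<or>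
     (\<forall>t\<in>{0..1}. cis (2 * pi * h t) = \<phi> (cis (2 * pi * (1 - t)))))"
proof -
  define u where "u = Arg2pi (\<phi> 1) / (2 * pi)"
  have n1: "norm (\<phi> z) = 1" if "norm z = 1" for z
    using homeomorphism_image1[OF \<phi>] that by force
  have u: "u \<in> {0..<1}" using Arg2pi[of "\<phi> 1"] by (auto simp: u_def field_simps)
  have cu: "cis (2 * pi * u) = \<phi> 1" using cis_Arg2pi n1[of 1] by (simp add: u_def)
  \<comment> \<open>Dividing by \<open>\<phi> 1\<close> puts the image of the basepoint on the
    branch cut of \<open>Arg2pi\<close>, the nonnegative reals. By injectivity no other point of the
    circle is sent there, so \<open>k\<close> is continuous on the open interval.\<close>
  define w where "w t = \<phi> (cis (2 * pi * t)) / \<phi> 1" for t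
  define k where "k t = u + Arg2pi (w t) / (2 * pi)" for t
  have nw: "norm (w t) = 1" for t by (simp add: w_def norm_divide n1)
  have ck: "cis (2 * pi * k t) = \<phi> (cis (2 * pi * t))" for t
  proof -
    have "cis (2 * pi * k t) = cis (2 * pi * u) * cis (Arg2pi (w t))"
      by (simp add: k_def cis_mult distrib_left)
    then show ?thesis using cis_Arg2pi[OF nw] cu n1[of 1] by (auto simp: w_def)
  qed
  have inj\<phi>: "\<phi> (cis (2 * pi * s)) = \<phi> (cis (2 * pi * t)) \<longleftrightarrow> s - t \<in> \<int>" for s t
    using homeomorphism_apply1[OF \<phi>, of "cis (2 * pi * s)"]
      homeomorphism_apply1[OF \<phi>, of "cis (2 * pi * t)"] cis_2pi_eq_iff[of s t] by auto
  have w1: "w t \<notin> \<real>\<^sub>\<ge>\<^sub>0" if t: "t \<in> {0<..<1}" for t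
  proof
    assume "w t \<in> \<real>\<^sub>\<ge>\<^sub>0"
    then have "w t = 1" using nw[of t] by (auto elim!: nonneg_Reals_cases)
    then have "\<phi> (cis (2 * pi * t)) = \<phi> (cis (2 * pi * 0))" using n1[of 1] by (auto simp: w_def)
    then have "t \<in> \<int>" using inj\<phi>[of t 0] by simp
    then show False using t Ints_abs_lt_1[of t] by auto
  qed
  have kim: "k t \<in> {u<..<u + 1}" if "t \<in> {0<..<1}" for t
  proof -
    have "Arg2pi (w t) \<noteq> 0" using w1[OF that] Arg2pi_eq_0 by (auto simp: complex_nonneg_Reals_iff complex_is_Real_iff)
    then show ?thesis using Arg2pi[of "w t"] by (auto simp: k_def field_simps)
  qed
  have "k ` {0<..<1} = {u<..<u + 1}"
  proof
    show "{u<..<u + 1} \<subseteq> k ` {0<..<1}"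
    proof
      fix v assume v: "v \<in> {u<..<u + 1}"
      \<comment> \<open>The preimage of the point at angle \<open>v\<close>. Its parameter
        \<open>t\<close> is not 0 because \<open>v\<close> lies strictly between \<open>u\<close>
        and \<open>u + 1\<close>; then \<open>k t\<close> and \<open>v\<close> differ by an integer
        inside one open unit interval, so they agree.\<close>
      define z where "z = \<psi> (cis (2 * pi * v))"
      have z: "norm z = 1" "\<phi> z = cis (2 * pi * v)"
        using homeomorphism_image2[OF \<phi>] homeomorphism_apply2[OF \<phi>] by (force simp: z_def)+
      define t where "t = Arg2pi z / (2 * pi)"
      have t: "0 \<le> t" "t < 1" using Arg2pi[of z] by (auto simp: t_def field_simps)
      have zt: "cis (2 * pi * t) = z" using cis_Arg2pi z by (simp add: t_def)
      have "t \<noteq> 0"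
      proof
        assume "t = 0"
        then have "cis (2 * pi * v) = cis (2 * pi * u)" using zt z cu by auto
        then show False using cis_2pi_eq_iff Ints_abs_lt_1[of "v - u"] v by auto
      qed
      then have t': "t \<in> {0<..<1}" using t by auto
      have "k t - v \<in> \<int>" using ck[of t] zt z cis_2pi_eq_iff by metis
      then have "k t = v" using kim[OF t'] v Ints_abs_lt_1[of "k t - v"] by auto
      then show "v \<in> k ` {0<..<1}" using t' by blast
    qed
  qed (use kim in blast)
  moreover have "inj_on k {0<..<1}"
  proof (rule inj_onI)
    fix s t assume st: "s \<in> {0<..<1}" "t \<in> {0<..<1::real}" "k s = k t"
    then have "s - t \<in> \<int>" using ck[of s] ck[of t] inj\<phi> by metis
    then show "s = t" using st Ints_abs_lt_1[of "s - t"] by auto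
  qed
  moreover have "continuous_on {0<..<1} k"
  proof -
    have "continuous_on UNIV (\<lambda>t. \<phi> (cis (2 * pi * t)))"
      by (rule continuous_on_compose2[OF homeomorphism_cont1[OF \<phi>]])
        (auto intro!: continuous_intros)
    then have "continuous_on {0<..<1} w"
      unfolding w_def[abs_def] using n1[of 1]
      by (auto intro!: continuous_intros elim: continuous_on_subset)
    moreover have "continuous_on (- \<real>\<^sub>\<ge>\<^sub>0) Arg2pi"
      by (intro continuous_at_imp_continuous_on ballI continuous_at_Arg2pi) auto
    ultimately have "continuous_on {0<..<1} (\<lambda>t. Arg2pi (w t))"
      using w1 by (auto intro: continuous_on_compose2)
    then show ?thesis unfolding k_def[abs_def] by (intro continuous_intros) auto
  qed
  ultimately have kk: "k ` {0<..<1} = {u<..<u + 1}"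
    "strict_mono_on {0<..<1} k \<or> strict_antimono_on {0<..<1} k"
    using injective_eq_monotone_map[of "{0<..<1}" k] by (auto simp: is_interval_oo)
  have cu1: "cis (2 * pi * (u + 1)) = \<phi> 1" using cu cis_2pi_eq_iff[of "u + 1" u] by simp
  have c1: "cis (2 * pi * 1) = 1" "cis (2 * pi * 0) = 1" by (auto simp: complex_eq_iff)
  have ends: "t = 0 \<or> t = 1 \<or> t \<in> {0<..<1}" if "t \<in> {0..1}" for t :: real using that by auto
  from kk(2) show ?thesis
  proof
    assume "strict_mono_on {0<..<1} k"
    then obtain h where h: "strict_mono_on {0..1} h" "h ` {0..1} = {u..u + 1}"
      and h01: "h 0 = u" "h 1 = u + 1" and hk: "\<And>t. t \<in> {0<..<1} \<Longrightarrow> h t = k t"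
      using strict_mono_on_extend_ends[of k u] kk(1) by metis
    have "cis (2 * pi * h t) = \<phi> (cis (2 * pi * t))" if "t \<in> {0..1}" for t
      using ends[OF that] ck[of t] cu cu1 c1 by (auto simp: h01 hk)
    then show ?thesis using u h by blast
  next
    assume anti: "strict_antimono_on {0<..<1} k"
    have "strict_mono_on {0<..<1} (\<lambda>t. k (1 - t))"
      using anti by (auto simp: monotone_on_def)
    moreover have "(\<lambda>t. k (1 - t)) ` {0<..<1} = {u<..<u + 1}"
    proof -
      have "(\<lambda>t. 1 - t) ` {0<..<1} = {0<..<1::real}"
        by (auto intro: image_eqI[where x = "1 - x" for x])
      then show ?thesis using kk(1) by (metis image_image)
    qed
    ultimately obtain h where h: "strict_mono_on {0..1} h" "h ` {0..1} = {u..u + 1}"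
      and h01: "h 0 = u" "h 1 = u + 1" and hk: "\<And>t. t \<in> {0<..<1} \<Longrightarrow> h t = k (1 - t)"
      using strict_mono_on_extend_ends[of "\<lambda>t. k (1 - t)" u] by metis
    have "cis (2 * pi * h t) = \<phi> (cis (2 * pi * (1 - t)))" if "t \<in> {0..1}" for t
      using ends[OF that] ck[of "1 - t"] cu cu1 c1 by (auto simp: h01 hk)
    then show ?thesis using u h by blast
  qed
qed

text \<open>The lift runs over \<open>{u..u + 1}\<close> while \<open>f2\<close> is controlled on
  \<open>{0..1}\<close>, so lifted values beyond 1 are moved back by a full turn. In the reversing
  case \<open>f1\<close> is reversed first.\<close>

lemma closed_rel_unit_speed:
  assumes "(f1, f2) \<in> closed_rel"
  shows "\<exists>\<theta>\<in>{0..<1}. (\<forall>t\<in>{0..1}. unit_speed f1 t = unit_speed f2 (frac (t + \<theta>))) \<or>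
    (\<forall>t\<in>{0..1}. unit_speed f1 t = unit_speed f2 (frac (\<theta> - t)))"
proof -
  obtain \<phi> \<psi> where f: "f1 \<in> param_curves" "f2 \<in> param_curves"
    and \<phi>: "homeomorphism (sphere (0::complex) 1) (sphere 0 1) \<phi> \<psi>"
    and eq: "\<And>t u. t \<in> {0..1} \<Longrightarrow> u \<in> {0..1} \<Longrightarrow> cis (2 * pi * u) = \<phi> (cis (2 * pi * t)) \<Longrightarrow> f1 t = f2 u"
    using assms by (auto simp: closed_rel_def param_loops_def)
  obtain u h where u: "u \<in> {0..<1}" and h: "strict_mono_on {0..1} h" "h ` {0..1} = {u..u + 1}"
    and dir: "(\<forall>t\<in>{0..1}. cis (2 * pi * h t) = \<phi> (cis (2 * pi * t))) \<or>
     (\<forall>t\<in>{0..1}. cis (2 * pi * h t) = \<phi> (cis (2 * pi * (1 - t))))"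
    using circle_homeomorphism_lift[OF \<phi>] by blast
  have hr: "h t \<in> {u..u + 1}" if "t \<in> {0..1}" for t using h(2) that by blast
  have shift: "cis (2 * pi * (h t - 1)) = cis (2 * pi * h t)" for t
    using cis_2pi_eq_iff[of "h t - 1" "h t"] by simp
  from dir show ?thesis
  proof
    assume *: "\<forall>t\<in>{0..1}. cis (2 * pi * h t) = \<phi> (cis (2 * pi * t))"
    have "\<exists>\<theta>\<in>{0..<1}. \<forall>t\<in>{0..1}. unit_speed f1 t = unit_speed f2 (frac (t + \<theta>))"
    proof (rule unit_speed_shift_reparam[OF f u h])
      fix t assume t: "t \<in> {0..1::real}"
      show "f1 t = f2 (h t)" if "h t \<le> 1" using t hr[OF t] u that * by (intro eq) auto
      show "f1 t = f2 (h t - 1)" if "h t \<ge> 1"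
        by (rule eq) (use t hr[OF t] u that * shift in auto)
    qed
    then show ?thesis by blast
  next
    assume *: "\<forall>t\<in>{0..1}. cis (2 * pi * h t) = \<phi> (cis (2 * pi * (1 - t)))"
    have "\<exists>\<theta>\<in>{0..<1}. \<forall>t\<in>{0..1}. unit_speed (\<lambda>t. f1 (1 - t)) t = unit_speed f2 (frac (t + \<theta>))"
    proof (rule unit_speed_shift_reparam[OF param_curves_reverse(1)[OF f(1)] f(2) u h])
      fix t assume t: "t \<in> {0..1::real}"
      show "f1 (1 - t) = f2 (h t)" if "h t \<le> 1" using t hr[OF t] u that * by (intro eq) auto
      show "f1 (1 - t) = f2 (h t - 1)" if "h t \<ge> 1"
        by (rule eq) (use t hr[OF t] u that * shift in auto)
    qed
    then obtain \<theta> where \<theta>: "\<theta> \<in> {0..<1}"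
      "\<And>t. t \<in> {0..1} \<Longrightarrow> unit_speed (\<lambda>t. f1 (1 - t)) t = unit_speed f2 (frac (t + \<theta>))" by blast
    \<comment> \<open>Undoing the reversal gives the argument \<open>1 - t + \<theta>\<close>, which
      \<open>frac\<close> does not distinguish from \<open>\<theta> - t\<close>.\<close>
    have "unit_speed f1 t = unit_speed f2 (frac (\<theta> - t))" if "t \<in> {0..1}" for t
    proof -
      have "unit_speed f1 t = unit_speed f2 (frac ((\<theta> - t) + 1))"
        using \<theta>(2)[of "1 - t"] param_curves_reverse(2)[OF f(1), of "1 - t"] that
        by (simp add: algebra_simps)
      then show ?thesis by (simp only: frac_1_eq)
    qed
    then show ?thesis using \<theta>(1) by blast
  qed
qed

subsection \<open>Classes of parametrizations\<close>

lemma equiv_open_rel: "equiv param_curves open_rel"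
proof (rule equivI)
  show "open_rel \<subseteq> param_curves \<times> param_curves" by (auto simp: open_rel_def)
  show "refl_on param_curves open_rel"
    using homeomorphism_ident by (fastforce simp: refl_on_def open_rel_def)
  show "sym open_rel"
  proof (rule symI)
    fix f1 f2 assume "(f1, f2) \<in> open_rel"
    then obtain \<phi> \<psi> where f: "f1 \<in> param_curves" "f2 \<in> param_curves"
      and \<phi>: "homeomorphism {0..1} {0..1} \<phi> \<psi>" and eq: "\<forall>t\<in>{0..1}. f1 t = f2 (\<phi> t)"
      by (auto simp: open_rel_def)
    have "f2 t = f1 (\<psi> t)" if "t \<in> {0..1}" for t
      using eq homeomorphism_apply2[OF \<phi> that] homeomorphism_image2[OF \<phi>] that
      by (metis imageI)
    with f homeomorphism_symD[OF \<phi>] show "(f2, f1) \<in> open_rel" by (auto simp: open_rel_def)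
  qed
  show "trans open_rel"
  proof (rule transI)
    fix f1 f2 f3 assume "(f1, f2) \<in> open_rel" "(f2, f3) \<in> open_rel"
    then obtain \<phi> \<psi> \<phi>' \<psi>' where f: "f1 \<in> param_curves" "f3 \<in> param_curves"
      and \<phi>: "homeomorphism {0..1} {0..1} \<phi> \<psi>" "homeomorphism {0..1} {0..1} \<phi>' \<psi>'"
      and eq: "\<forall>t\<in>{0..1}. f1 t = f2 (\<phi> t)" "\<forall>t\<in>{0..1}. f2 t = f3 (\<phi>' t)"
      by (auto simp: open_rel_def)
    have "f1 t = f3 ((\<phi>' \<circ> \<phi>) t)" if "t \<in> {0..1}" for t
      using eq homeomorphism_image1[OF \<phi>(1)] that by (metis imageI comp_apply)
    with f homeomorphism_compose[OF \<phi>] show "(f1, f3) \<in> open_rel" by (auto simp: open_rel_def)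
  qed
qed

lemma cis_2pi_surj:
  assumes "norm z = 1"
  obtains t where "t \<in> {0..1}" "cis (2 * pi * t) = z"
proof
  show "Arg2pi z / (2 * pi) \<in> {0..1}" using Arg2pi[of z] by (auto simp: field_simps)
qed (use cis_Arg2pi assms in simp)

text \<open>The only distinct parameters of one circle point are 0 and 1. This gives reflexivity of
  \<open>closed_rel\<close>, which quantifies over all parameters of corresponding points.\<close>

lemma param_loops_cis_2pi:
  assumes "f \<in> param_loops" "s \<in> {0..1}" "t \<in> {0..1}" "cis (2 * pi * s) = cis (2 * pi * t)"
  shows "f s = f t"
proof -
  have "s - t \<in> \<int>" using assms(4) cis_2pi_eq_iff by blast
  then have "s = t \<or> (s = 0 \<and> t = 1) \<or> (s = 1 \<and> t = 0)"
    using assms(2,3) Ints_abs_lt_1[of "s - t"] by (auto; linarith)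
  then show ?thesis using assms(1) by (auto simp: param_loops_def)
qed

lemma equiv_closed_rel: "equiv param_loops closed_rel"
proof (rule equivI)
  show "closed_rel \<subseteq> param_loops \<times> param_loops" by (auto simp: closed_rel_def)
  show "refl_on param_loops closed_rel"
  proof (rule refl_onI)
    fix f assume f: "f \<in> param_loops"
    have "f t = f u" if "t \<in> {0..1}" "u \<in> {0..1}" "cis (2 * pi * u) = cis (2 * pi * t)" for t u
      using param_loops_cis_2pi[OF f that(1,2)] that(3) by simp
    with f homeomorphism_ident[of "sphere (0::complex) 1"] show "(f, f) \<in> closed_rel"
      unfolding closed_rel_def by blast
  qed
  show "sym closed_rel"
  proof (rule symI)
    fix f1 f2 assume "(f1, f2) \<in> closed_rel"
    then obtain \<phi> \<psi> where f: "f1 \<in> param_loops" "f2 \<in> param_loops"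
      and \<phi>: "homeomorphism (sphere (0::complex) 1) (sphere 0 1) \<phi> \<psi>"
      and eq: "\<And>t u. t \<in> {0..1} \<Longrightarrow> u \<in> {0..1} \<Longrightarrow> cis (2 * pi * u) = \<phi> (cis (2 * pi * t)) \<Longrightarrow> f1 t = f2 u"
      by (auto simp: closed_rel_def)
    have "f2 t = f1 u" if "t \<in> {0..1}" "u \<in> {0..1}" "cis (2 * pi * u) = \<psi> (cis (2 * pi * t))" for t u
    proof -
      have "cis (2 * pi * t) = \<phi> (cis (2 * pi * u))"
        using homeomorphism_apply2[OF \<phi>] that by simp
      then show ?thesis using eq that by simp
    qed
    with f homeomorphism_symD[OF \<phi>] show "(f2, f1) \<in> closed_rel" by (auto simp: closed_rel_def)
  qed
  show "trans closed_rel"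
  proof (rule transI)
    fix f1 f2 f3 assume "(f1, f2) \<in> closed_rel" "(f2, f3) \<in> closed_rel"
    then obtain \<phi> \<psi> \<phi>' \<psi>' where f: "f1 \<in> param_loops" "f3 \<in> param_loops"
      and \<phi>: "homeomorphism (sphere (0::complex) 1) (sphere 0 1) \<phi> \<psi>"
        "homeomorphism (sphere (0::complex) 1) (sphere 0 1) \<phi>' \<psi>'"
      and eq: "\<And>t u. t \<in> {0..1} \<Longrightarrow> u \<in> {0..1} \<Longrightarrow> cis (2 * pi * u) = \<phi> (cis (2 * pi * t)) \<Longrightarrow> f1 t = f2 u"
        "\<And>t u. t \<in> {0..1} \<Longrightarrow> u \<in> {0..1} \<Longrightarrow> cis (2 * pi * u) = \<phi>' (cis (2 * pi * t)) \<Longrightarrow> f2 t = f3 u"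
      by (auto simp: closed_rel_def)
    have "f1 t = f3 u"
      if tu: "t \<in> {0..1}" "u \<in> {0..1}" "cis (2 * pi * u) = (\<phi>' \<circ> \<phi>) (cis (2 * pi * t))" for t u
    proof -
      \<comment> \<open>The intermediate circle point needs a parameter \<open>v\<close> in
        \<open>{0..1}\<close>, since both relations speak of parameters.\<close>
      have "norm (\<phi> (cis (2 * pi * t))) = 1" using homeomorphism_image1[OF \<phi>(1)] by force
      then obtain v where "v \<in> {0..1}" "cis (2 * pi * v) = \<phi> (cis (2 * pi * t))"
        using cis_2pi_surj by metis
      then show ?thesis using eq(1)[of t v] eq(2)[of v u] tu by simp
    qed
    with f homeomorphism_compose[OF \<phi>] show "(f1, f3) \<in> closed_rel"
      unfolding closed_rel_def by blast
  qed
qed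

lemma representative_open:
  assumes "c \<in> param_curves // open_rel"
  shows "representative (Inl c) \<in> c"
  using in_quotient_imp_non_empty[OF equiv_open_rel assms] by (auto simp: representative_def some_in_eq)

lemma representative_closed:
  assumes "c \<in> param_loops // closed_rel"
  shows "representative (Inr c) \<in> c"
  using in_quotient_imp_non_empty[OF equiv_closed_rel assms] by (auto simp: representative_def some_in_eq)

lemma representative_param_curves:
  assumes "C \<in> curve_space"
  shows "representative C \<in> param_curves"
  using assms representative_open representative_closed
    in_quotient_imp_subset[OF equiv_open_rel] in_quotient_imp_subset[OF equiv_closed_rel]
  unfolding curve_space_def param_loops_def by blast

subsection \<open>Traversals and similarities\<close>

text \<open>Traversals of closed curves go through \<open>frac\<close>, which never returns 1; equal
  end values ensure that nothing is lost or torn there.\<close>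

lemma unit_rep_closed:
  assumes "c \<in> param_loops // closed_rel"
  shows "unit_rep (Inr c) 0 = unit_rep (Inr c) 1"
proof -
  have "representative (Inr c) \<in> param_loops"
    using representative_closed[OF assms] in_quotient_imp_subset[OF equiv_closed_rel assms] by blast
  then show ?thesis unfolding unit_rep_unit_speed
    by (simp add: param_loops_def unit_speed_ends)
qed

lemma frac_in_unit: "frac (x::real) \<in> {0..1}" "frac (x::real) \<in> {0..<1}"
  using frac_lt_1[of x] by simp_all

lemma frac_frac_diff: "frac (frac x - y) = frac (x - y :: real)"
  using frac_add_simps(1)[of x "- y"] by simp

lemma path_unit_rep: "C \<in> curve_space \<Longrightarrow> path (unit_rep C)"
  unfolding unit_rep_unit_speed path_def
  by (intro continuous_on_unit_speed representative_param_curves)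

text \<open>Links shifts by \<open>frac\<close> to \<open>shiftpath\<close>, whose continuity is
  known. At \<open>t + \<theta> = 1\<close> one formula reads \<open>U 1\<close> and the other
  \<open>U 0\<close>, hence the loop condition.\<close>

lemma shiftpath_frac:
  assumes "U 0 = U 1" "\<theta> \<in> {0..<1}" "t \<in> {0..1}"
  shows "shiftpath \<theta> U t = U (frac (t + \<theta>))"
proof -
  consider "t + \<theta> < 1" | "t + \<theta> = 1" | "1 < t + \<theta>" "t + \<theta> < 2" using assms by fastforce
  then show ?thesis
  proof cases
    case 1
    then have "frac (t + \<theta>) = t + \<theta>" using assms by (simp add: frac_eq)
    then show ?thesis using 1 by (simp add: shiftpath_def add.commute)
  next
    case 2
    then show ?thesis using assms by (simp add: shiftpath_def add.commute)
  next
    case 3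
    then have "frac (t + \<theta>) = t + \<theta> - 1"
      using frac_1_eq[of "t + \<theta> - 1"] frac_eq[of "t + \<theta> - 1"] by simp
    then show ?thesis using 3 by (simp add: shiftpath_def add.commute)
  qed
qed

lemma path_frac_shift:
  assumes "path U" "U 0 = U 1" "\<theta> \<in> {0..<1}"
  shows "path (\<lambda>t. U (frac (t + \<theta>)))" "path (\<lambda>t. U (frac (\<theta> - t)))"
proof -
  have p: "path (shiftpath \<theta> U)"
    using assms by (intro path_shiftpath) (auto simp: pathfinish_def pathstart_def)
  show "path (\<lambda>t. U (frac (t + \<theta>)))"
    unfolding path_def
    by (rule continuous_on_eq[OF p[unfolded path_def]]) (rule shiftpath_frac[OF assms(2,3)])
  have rev: "reversepath (shiftpath \<theta> U) t = U (frac (\<theta> - t))" if "t \<in> {0..1}" for t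
  proof -
    have "reversepath (shiftpath \<theta> U) t = U (frac ((\<theta> - t) + 1))"
      using shiftpath_frac[of U \<theta> "1 - t", OF assms(2,3)] that
      by (simp add: reversepath_def algebra_simps)
    then show ?thesis by (simp only: frac_1_eq)
  qed
  have "path (reversepath (shiftpath \<theta> U))" using p by simp
  then show "path (\<lambda>t. U (frac (\<theta> - t)))"
    unfolding path_def by (rule continuous_on_eq) (rule rev)
qed

lemma path_traversals:
  assumes "C \<in> curve_space" "\<alpha> \<in> traversals C"
  shows "path \<alpha>"
proof (cases C)
  case (Inl c)
  then show ?thesis using assms path_unit_rep[OF assms(1)] path_reversepath[of "unit_rep C"]
    by (auto simp: traversals_def reversepath_def)
next
  case (Inr c)
  then have "c \<in> param_loops // closed_rel" using assms(1) by (auto simp: curve_space_def)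
  from path_frac_shift[OF path_unit_rep[OF assms(1)]] unit_rep_closed[OF this] assms(2) Inr
  show ?thesis by (auto simp: traversals_def)
qed

text \<open>With the trace expressed by traversals, its equivariance follows from the matching of
  traversals alone.\<close>

lemma trace_of_traversals:
  assumes "C \<in> curve_space"
  shows "trace_of C = (\<Union>\<alpha>\<in>traversals C. \<alpha> ` {0..1})"
proof -
  have "trace_of C = unit_rep C ` {0..1}"
    unfolding unit_rep_unit_speed trace_of_def
    using unit_speed_image[OF representative_param_curves[OF assms]] by simp
  also have "\<dots> = (\<Union>\<alpha>\<in>traversals C. \<alpha> ` {0..1})"
  proof
    show "(\<Union>\<alpha>\<in>traversals C. \<alpha> ` {0..1}) \<subseteq> unit_rep C ` {0..1}"
      by (cases C) (auto simp: traversals_def less_imp_le[OF frac_lt_1])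
    show "unit_rep C ` {0..1} \<subseteq> (\<Union>\<alpha>\<in>traversals C. \<alpha> ` {0..1})"
    proof (cases C)
      case (Inl c)
      then show ?thesis by (auto simp: traversals_def)
    next
      case (Inr c)
      then have "c \<in> param_loops // closed_rel" using assms by (auto simp: curve_space_def)
      then have *: "unit_rep C 1 = unit_rep C (frac (0 + 0))"
        using unit_rep_closed Inr by simp
      have "\<exists>s\<in>{0..1}. unit_rep C t = unit_rep C (frac (s + 0))" if "t \<in> {0..1}" for t
      proof (cases "t = 1")
        case True
        then show ?thesis using * by (intro bexI[of _ 0]) auto
      qed (use that in \<open>intro bexI[of _ t], auto\<close>)
      moreover have "(\<lambda>t. unit_rep C (frac (t + 0))) \<in> traversals C"
        using Inr by (auto simp: traversals_def intro!: bexI[of _ 0])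
      ultimately show ?thesis by blast
    qed
  qed
  finally show ?thesis .
qed

lemma compact_trace_of: "C \<in> curve_space \<Longrightarrow> compact (trace_of C)"
  unfolding trace_of_def
  by (intro compact_continuous_image param_curvesD representative_param_curves) auto

section \<open>Action of a similarity on classes and traversals\<close>

locale similarity =
  fixes g :: "plane \<Rightarrow> plane" and r :: real and Q :: "real^2^2" and b :: plane
  assumes r_pos: "r > 0" and orth: "orthogonal_matrix Q"
    and g_eq: "g x = r *\<^sub>R (Q *v x) + b"
begin

lemma norm_Q: "norm (Q *v x) = norm x"
  using orth orthogonal_transformation_matrix[of "(*v) Q"]
  by (auto simp: orthogonal_transformation matrix_vector_mul_linear matrix_of_matrix_vector_mul)

lemma norm_g_diff: "norm (g x - g y) = r * norm (x - y)"
proof -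
  have "g x - g y = r *\<^sub>R (Q *v (x - y))"
    by (simp add: g_eq matrix_vector_mult_diff_distrib scaleR_diff_right)
  then show ?thesis using r_pos norm_Q by simp
qed

lemma inj_g: "inj g"
  using norm_g_diff r_pos by (intro injI) (metis eq_iff_diff_eq_0 mult_eq_0_iff norm_eq_zero order_less_irrefl)

lemma g_eq_iff: "g x = g y \<longleftrightarrow> x = y"
  using inj_g by (simp add: inj_eq)

lemma continuous_on_g: "continuous_on S g"
proof -
  have "continuous_on S (\<lambda>x. r *\<^sub>R (Q *v x) + b)"
    by (intro continuous_intros matrix_vector_mult_linear_continuous_on)
  then show ?thesis using g_eq by presburger
qed

lemma surj_g: "surj g"
proof (rule surjI)
  fix y
  have "Q *v (transpose Q *v x) = x" for x
    using orth by (simp only: matrix_vector_mul_assoc orthogonal_matrix_def matrix_vector_mul_lid)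
  then show "g (transpose Q *v ((1 / r) *\<^sub>R (y - b))) = y"
    unfolding g_eq using r_pos by simp
qed

lemma g_convex_comb: "g ((1 - l) *\<^sub>R x + l *\<^sub>R y) = (1 - l) *\<^sub>R g x + l *\<^sub>R g y"
  by (simp add: g_eq matrix_vector_right_distrib scaleR_matrix_vector_assoc[symmetric]
      matrix_vector_mult_scaleR algebra_simps)

lemma path_length_g:
  assumes "finite_length f" "0 \<le> a" "a \<le> c" "c \<le> 1"
  shows "path_length (g \<circ> f) a c = r * path_length f a c"
proof -
  have "r * Sup (polygonal_lengths f a c) = (SUP s\<in>polygonal_lengths f a c. r * s)"
    using r_pos polygonal_lengths_nonempty[OF assms(3)] finite_length_subinterval[OF assms]
    by (intro continuous_at_Sup_mono) (auto intro!: monoI continuous_intros)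
  then show ?thesis by (simp add: path_length_def polygonal_lengths_scale[OF norm_g_diff])
qed

lemma arc_length_map_g:
  assumes "finite_length f" "t \<in> {0..1}"
  shows "arc_length_map (g \<circ> f) t = r * arc_length_map f t"
  using path_length_g[OF assms(1), of 0 t] assms(2) by (simp add: arc_length_map_def)

lemma param_curves_g:
  assumes "f \<in> param_curves"
  shows "g \<circ> f \<in> param_curves"
proof -
  note fD = param_curvesD[OF assms]
  have "continuous_on {0..1} (g \<circ> f)"
    by (intro continuous_on_compose fD continuous_on_g)
  moreover have "bdd_above (polygonal_lengths (g \<circ> f) 0 1)"
  proof -
    obtain M where M: "\<And>S. S \<in> polygonal_lengths f 0 1 \<Longrightarrow> S \<le> M"
      using fD(2) by (auto simp: finite_length_def bdd_above_def)
    then show ?thesis using r_pos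
      by (auto simp: polygonal_lengths_scale[OF norm_g_diff] bdd_above_def intro!: exI[of _ "r * M"])
  qed
  moreover have "strict_mono_on {0..1} (arc_length_map (g \<circ> f))"
    using fD(3) r_pos arc_length_map_g[OF fD(2)] by (auto simp: strict_mono_on_def)
  ultimately show ?thesis by (simp add: param_curves_def)
qed

text \<open>Partial and total length both acquire the factor \<open>r\<close>, which cancels in the
  length fraction.\<close>

lemma unit_speed_g:
  assumes "f \<in> param_curves" "x \<in> {0..1}"
  shows "unit_speed (g \<circ> f) x = g (unit_speed f x)"
proof -
  note fin = param_curvesD(2)[OF assms(1)]
  obtain t where t: "t \<in> {0..1}" "x = arc_length_map f t / path_length f 0 1"
    using arc_length_parameter[OF assms] by metis
  then have "x = arc_length_map (g \<circ> f) t / path_length (g \<circ> f) 0 1"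
    using arc_length_map_g[OF fin t(1)] path_length_g[OF fin, of 0 1] r_pos by simp
  then show ?thesis
    using unit_speed_arc_length[OF param_curves_g[OF assms(1)] t(1)]
      unit_speed_arc_length[OF assms(1) t(1)] t(2) by simp
qed

lemma open_rel_g: "(f1, f2) \<in> open_rel \<Longrightarrow> (g \<circ> f1, g \<circ> f2) \<in> open_rel"
  unfolding open_rel_def using param_curves_g by auto

lemma closed_rel_g: "(f1, f2) \<in> closed_rel \<Longrightarrow> (g \<circ> f1, g \<circ> f2) \<in> closed_rel"
  unfolding closed_rel_def using param_curves_g
  by (clarsimp simp: param_loops_def) metis

text \<open>All members of a class have equivalent images, so the union in
  \<open>curve_image\<close> is already the class of any single one.\<close>

lemma image_class_open:
  assumes c: "c \<in> param_curves // open_rel" and f: "f \<in> c"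
  shows "open_rel `` {g \<circ> f | f. f \<in> c} = open_rel `` {g \<circ> f}"
proof -
  have "open_rel `` {g \<circ> f'} = open_rel `` {g \<circ> f}" if "f' \<in> c" for f'
    using equiv_class_eq[OF equiv_open_rel] open_rel_g
      in_quotient_imp_in_rel[OF equiv_open_rel c] f that by blast
  then show ?thesis using f by blast
qed

lemma image_class_closed:
  assumes c: "c \<in> param_loops // closed_rel" and f: "f \<in> c"
  shows "closed_rel `` {g \<circ> f | f. f \<in> c} = closed_rel `` {g \<circ> f}"
proof -
  have "closed_rel `` {g \<circ> f'} = closed_rel `` {g \<circ> f}" if "f' \<in> c" for f'
    using equiv_class_eq[OF equiv_closed_rel] closed_rel_g
      in_quotient_imp_in_rel[OF equiv_closed_rel c] f that by blast
  then show ?thesis using f by blast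
qed

lemma curve_image_open:
  assumes "c \<in> param_curves // open_rel"
  obtains c' where "curve_image g (Inl c) = Inl c'" "c' \<in> param_curves // open_rel"
    "(g \<circ> representative (Inl c), representative (Inl c')) \<in> open_rel"
proof -
  let ?f = "representative (Inl c)" and ?c' = "open_rel `` {g \<circ> representative (Inl c)}"
  have f: "?f \<in> c" using representative_open[OF assms] .
  then have "g \<circ> ?f \<in> param_curves"
    using in_quotient_imp_subset[OF equiv_open_rel assms] param_curves_g by blast
  then have c': "?c' \<in> param_curves // open_rel" by (rule quotientI)
  have "curve_image g (Inl c) = Inl ?c'"
    using image_class_open[OF assms f] by (simp add: curve_image_def)
  with that c' representative_open[OF c'] show thesis by blast
qed

lemma curve_image_closed:
  assumes "c \<in> param_loops // closed_rel"
  obtains c' where "curve_image g (Inr c) = Inr c'" "c' \<in> param_loops // closed_rel"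
    "(g \<circ> representative (Inr c), representative (Inr c')) \<in> closed_rel"
proof -
  let ?f = "representative (Inr c)" and ?c' = "closed_rel `` {g \<circ> representative (Inr c)}"
  have f: "?f \<in> c" using representative_closed[OF assms] .
  then have "g \<circ> ?f \<in> param_loops"
    using in_quotient_imp_subset[OF equiv_closed_rel assms] param_curves_g
    by (auto simp: param_loops_def)
  then have c': "?c' \<in> param_loops // closed_rel" by (rule quotientI)
  have "curve_image g (Inr c) = Inr ?c'"
    using image_class_closed[OF assms f] by (simp add: curve_image_def)
  with that c' representative_closed[OF c'] show thesis by blast
qed

lemma curve_image_in_curve_space:
  assumes "C \<in> curve_space"
  shows "curve_image g C \<in> curve_space"
  using assms unfolding curve_space_def by (auto elim!: PlusE) (metis InlI InrI curve_image_open curve_image_closed)+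

lemma unit_rep_image_open:
  assumes c: "c \<in> param_curves // open_rel"
  defines "U \<equiv> unit_rep (Inl c)" and "U' \<equiv> unit_rep (curve_image g (Inl c))"
  shows "(\<forall>t\<in>{0..1}. U' t = g (U t)) \<or> (\<forall>t\<in>{0..1}. U' t = g (U (1 - t)))"
proof -
  let ?f = "representative (Inl c)"
  have f: "?f \<in> param_curves"
    using representative_open[OF c] in_quotient_imp_subset[OF equiv_open_rel c] by blast
  obtain c' where c': "curve_image g (Inl c) = Inl c'"
    and rel: "(g \<circ> ?f, representative (Inl c')) \<in> open_rel"
    using curve_image_open[OF c] by metis
  from rel have "(representative (Inl c'), g \<circ> ?f) \<in> open_rel"
    using equiv_open_rel by (auto simp: equiv_def dest: symD)
  from open_rel_unit_speed[OF this] unit_speed_g[OF f] show ?thesis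
    unfolding U_def U'_def c' unit_rep_unit_speed by auto
qed

lemma unit_rep_image_closed:
  assumes c: "c \<in> param_loops // closed_rel"
  defines "U \<equiv> unit_rep (Inr c)" and "U' \<equiv> unit_rep (curve_image g (Inr c))"
  shows "\<exists>\<theta>\<in>{0..<1}. (\<forall>t\<in>{0..1}. U' t = g (U (frac (t + \<theta>)))) \<or>
    (\<forall>t\<in>{0..1}. U' t = g (U (frac (\<theta> - t))))"
proof -
  let ?f = "representative (Inr c)"
  have f: "?f \<in> param_curves"
    using representative_closed[OF c] in_quotient_imp_subset[OF equiv_closed_rel c]
    by (auto simp: param_loops_def)
  obtain c' where c': "curve_image g (Inr c) = Inr c'"
    and rel: "(g \<circ> ?f, representative (Inr c')) \<in> closed_rel"
    using curve_image_closed[OF c] by metis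
  from rel have "(representative (Inr c'), g \<circ> ?f) \<in> closed_rel"
    using equiv_closed_rel by (auto simp: equiv_def dest: symD)
  moreover have "frac x \<in> {0..1}" for x :: real using frac_lt_1[of x] by simp
  ultimately show ?thesis using closed_rel_unit_speed[of "representative (Inr c')"] unit_speed_g[OF f]
    unfolding U_def U'_def c' unit_rep_unit_speed by metis
qed

text \<open>For open curves the two traversals are at most swapped. For closed curves the basepoint
  of the new representative is unrelated to the old one, but the family of all shifts and reversals
  absorbs any shift.\<close>

lemma traversals_image:
  assumes C: "C \<in> curve_space"
  shows "(\<forall>\<alpha>\<in>traversals C. \<exists>\<alpha>'\<in>traversals (curve_image g C). \<forall>t\<in>{0..1}. \<alpha>' t = g (\<alpha> t)) \<and>
    (\<forall>\<alpha>'\<in>traversals (curve_image g C). \<exists>\<alpha>\<in>traversals C. \<forall>t\<in>{0..1}. \<alpha>' t = g (\<alpha> t))"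
proof (cases C)
  case (Inl c)
  then have c: "c \<in> param_curves // open_rel" using C by (auto simp: curve_space_def)
  obtain c' where c': "curve_image g C = Inl c'" using curve_image_open[OF c] Inl by metis
  let ?U = "unit_rep C" and ?U' = "unit_rep (curve_image g C)"
  have tr: "traversals C = {?U, \<lambda>t. ?U (1 - t)}"
    "traversals (curve_image g C) = {?U', \<lambda>t. ?U' (1 - t)}"
    unfolding c' using Inl by (auto simp: traversals_def)
  from unit_rep_image_open[OF c] Inl consider
    "\<And>t. t \<in> {0..1} \<Longrightarrow> ?U' t = g (?U t)" | "\<And>t. t \<in> {0..1} \<Longrightarrow> ?U' t = g (?U (1 - t))"
    by blast
  then show ?thesis by cases (auto simp: tr)
next
  case (Inr c)
  then have c: "c \<in> param_loops // closed_rel" using C by (auto simp: curve_space_def)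
  obtain c' where c': "curve_image g C = Inr c'" using curve_image_closed[OF c] Inr by metis
  let ?U = "unit_rep C" and ?U' = "unit_rep (curve_image g C)"
  define F where "F U \<theta> = (\<lambda>t. U (frac (t + \<theta>)) :: plane)" for U and \<theta> :: real
  define B where "B U \<theta> = (\<lambda>t. U (frac (\<theta> - t)) :: plane)" for U and \<theta> :: real
  have tr: "traversals C = F ?U ` {0..<1} \<union> B ?U ` {0..<1}"
    "traversals (curve_image g C) = F ?U' ` {0..<1} \<union> B ?U' ` {0..<1}"
    unfolding c' using Inr by (auto simp: traversals_def F_def B_def)
  obtain \<theta> where "(\<forall>t\<in>{0..1}. ?U' t = g (?U (frac (t + \<theta>)))) \<or>
      (\<forall>t\<in>{0..1}. ?U' t = g (?U (frac (\<theta> - t))))"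
    using unit_rep_image_closed[OF c] Inr by blast
  then consider
    (shift) "\<And>t. t \<in> {0..1} \<Longrightarrow> ?U' t = g (?U (frac (t + \<theta>)))"
    | (reverse) "\<And>t. t \<in> {0..1} \<Longrightarrow> ?U' t = g (?U (frac (\<theta> - t)))"
    by blast
  then show ?thesis
  proof cases
    case shift
    \<comment> \<open>Starting at \<open>\<eta>\<close> on the old loop means starting at
      \<open>\<eta> - \<theta>\<close> on the new one. The equations hold for every
      \<open>t\<close>, because \<open>frac\<close> always lands in \<open>{0..1}\<close>.\<close>
    have 1: "F ?U' (frac (\<eta> - \<theta>)) t = g (F ?U \<eta> t)" "B ?U' (frac (\<eta> - \<theta>)) t = g (B ?U \<eta> t)"
      "F ?U' \<eta> t = g (F ?U (frac (\<eta> + \<theta>)) t)" "B ?U' \<eta> t = g (B ?U (frac (\<eta> + \<theta>)) t)" for \<eta> t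
      using shift[OF frac_in_unit(1)] by (auto simp: F_def B_def frac_frac_diff algebra_simps)
    show ?thesis unfolding tr using 1 frac_in_unit(2) by blast
  next
    case reverse
    \<comment> \<open>Reversal exchanges forward and backward traversals and moves basepoints by
      \<open>\<eta> \<mapsto> \<theta> - \<eta>\<close>, an involution modulo 1.\<close>
    have 1: "B ?U' (frac (\<theta> - \<eta>)) t = g (F ?U \<eta> t)" "F ?U' (frac (\<theta> - \<eta>)) t = g (B ?U \<eta> t)"
      "F ?U' \<eta> t = g (B ?U (frac (\<theta> - \<eta>)) t)" "B ?U' \<eta> t = g (F ?U (frac (\<theta> - \<eta>)) t)" for \<eta> t
      using reverse[OF frac_in_unit(1)]
      by (auto simp: F_def B_def frac_frac_diff frac_diff_simp algebra_simps)
    show ?thesis unfolding tr using 1 frac_in_unit(2) by blast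
  qed
qed

lemma traversal_image:
  assumes "C \<in> curve_space" "\<alpha> \<in> traversals C"
  obtains \<alpha>' where "\<alpha>' \<in> traversals (curve_image g C)" "\<forall>t\<in>{0..1}. \<alpha>' t = g (\<alpha> t)"
  using traversals_image[OF assms(1)] assms(2) by blast

lemma traversal_preimage:
  assumes "C \<in> curve_space" "\<alpha>' \<in> traversals (curve_image g C)"
  obtains \<alpha> where "\<alpha> \<in> traversals C" "\<forall>t\<in>{0..1}. \<alpha>' t = g (\<alpha> t)"
  using traversals_image[OF assms(1)] assms(2) by blast

lemma trace_of_image:
  assumes "C \<in> curve_space"
  shows "trace_of (curve_image g C) = g ` trace_of C"
  unfolding trace_of_traversals[OF assms] trace_of_traversals[OF curve_image_in_curve_space[OF assms]]
  using traversals_image[OF assms] by (force simp: image_iff)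

end

subsection \<open>Lebesgue measure on the circle\<close>

text \<open>A path is continuous on \<open>{0..1}\<close> only, so measurability is read off from
  the preimage of \<open>B\<close> inside that interval, which is closed and bounded.\<close>

lemma set_integrable_indicator_path:
  assumes "path \<alpha>" "closed B"
  shows "set_integrable lborel {0..1} (\<lambda>t. indicator B (\<alpha> t) :: real)"
proof -
  have "closed ({0..1} \<inter> \<alpha> -` B)"
    using assms by (intro continuous_closed_preimage) (auto simp: path_def)
  moreover have "bounded ({0..1} \<inter> \<alpha> -` B)" by (rule bounded_subset[of "{0..1}"]) auto
  ultimately have "integrable lborel (indicator ({0..1} \<inter> \<alpha> -` B) :: real \<Rightarrow> real)"
    by (intro integrable_real_indicator emeasure_bounded_finite) auto
  moreover have "indicator ({0..1} \<inter> \<alpha> -` B) =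
      (\<lambda>t. indicator {0..1} t *\<^sub>R indicator B (\<alpha> t) :: real)"
    by (auto simp: fun_eq_iff indicator_def)
  ultimately show ?thesis by (simp add: set_integrable_def)
qed

text \<open>The half-open interval is a fundamental domain of the circle, on which shifts are
  bijective; the extra endpoint is a null set.\<close>

lemma set_lint_unit_half_open:
  fixes F :: "real \<Rightarrow> real"
  assumes "set_integrable lborel {0..1} F"
  shows "(LINT t:{0..1}|lborel. F t) = (LINT t:{0..<1}|lborel. F t)"
proof -
  have F: "set_integrable lborel {0..<1} F" "set_integrable lborel {1} F"
    by (auto intro: set_integrable_subset[OF assms])
  have "{0..1} = {0..<1} \<union> {1::real}" by auto
  then have "(LINT t:{0..1}|lborel. F t) = (LINT t:{0..<1}|lborel. F t) + (LINT t:{1}|lborel. F t)"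
    using set_integral_Un[OF _ F] by simp
  then show ?thesis using set_integral_at_point[OF F(2)] by simp
qed

lemma set_lint_frac_shift:
  fixes F :: "real \<Rightarrow> real"
  assumes F: "set_integrable lborel {0..<1} F" and \<theta>: "\<theta> \<in> {0..<1}"
  shows "(LINT t:{0..<1}|lborel. F (frac (t + \<theta>))) = (LINT t:{0..<1}|lborel. F t)"
proof -
  \<comment> \<open>\<open>A\<close> is the part of \<open>F\<close> met before the shifted
    parameter wraps around, \<open>B\<close> the part met afterwards. Each piece is moved by a
    translation, written below with \<open>1 * t\<close> to fit the affine substitution
    rule.\<close>
  define A B where "A t = indicator {\<theta>..<1} t *\<^sub>R F t" and "B t = indicator {0..<\<theta>} t *\<^sub>R F t" for t
  have sets: "set_integrable lborel {\<theta>..<1} F" "set_integrable lborel {0..<\<theta>} F"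
    using \<theta> by (auto intro!: set_integrable_subset[OF F])
  then have int: "integrable lborel A" "integrable lborel B"
    by (simp_all add: A_def[abs_def] B_def[abs_def] set_integrable_def)
  have "indicator {0..<1} t *\<^sub>R F (frac (t + \<theta>)) = A (\<theta> + 1 * t) + B (\<theta> - 1 + 1 * t)" for t
  proof -
    consider "t \<notin> {0..<1}" | "t \<in> {0..<1}" "t + \<theta> < 1" | "t \<in> {0..<1}" "1 \<le> t + \<theta>" by force
    then show ?thesis
    proof cases
      case 2
      then have "frac (t + \<theta>) = t + \<theta>" using \<theta> by (simp add: frac_eq)
      then show ?thesis using 2 \<theta> by (auto simp: A_def B_def indicator_def add.commute)
    next
      case 3
      then have frac: "frac (t + \<theta>) = t + \<theta> - 1"
        using \<theta> frac_1_eq[of "t + \<theta> - 1"] frac_eq[of "t + \<theta> - 1"] by simp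
      show ?thesis
        unfolding frac using 3 \<theta> by (auto simp: A_def B_def indicator_def algebra_simps)
    qed (use \<theta> in \<open>auto simp: A_def B_def indicator_def\<close>)
  qed
  then have "(LINT t:{0..<1}|lborel. F (frac (t + \<theta>))) =
      (LINT t|lborel. A (\<theta> + 1 * t) + B (\<theta> - 1 + 1 * t))"
    unfolding set_lebesgue_integral_def by simp
  also have "\<dots> = (LINT t|lborel. A (\<theta> + 1 * t)) + (LINT t|lborel. B (\<theta> - 1 + 1 * t))"
    by (intro Bochner_Integration.integral_add lborel_integrable_real_affine int) auto
  also have "\<dots> = (LINT t|lborel. A t) + (LINT t|lborel. B t)"
    using lborel_integral_real_affine[of 1 A \<theta>] lborel_integral_real_affine[of 1 B "\<theta> - 1"] by simp
  also have "\<dots> = (LINT t:{\<theta>..<1}|lborel. F t) + (LINT t:{0..<\<theta>}|lborel. F t)"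
    by (simp add: A_def B_def set_lebesgue_integral_def)
  also have "\<dots> = (LINT t:{\<theta>..<1} \<union> {0..<\<theta>}|lborel. F t)"
    using set_integral_Un[OF _ sets] by auto
  also have "{\<theta>..<1} \<union> {0..<\<theta>} = {0..<1}" using \<theta> by auto
  finally show ?thesis .
qed

lemma set_lint_unit_reverse:
  fixes F :: "real \<Rightarrow> real"
  shows "(LINT t:{0..1}|lborel. F (1 - t)) = (LINT t:{0..1}|lborel. F t)"
proof -
  have "indicator {0..1} (1 + - 1 * t) = (indicator {0..1} t :: real)" for t :: real
    by (auto simp: indicator_def)
  then show ?thesis
    unfolding set_lebesgue_integral_def
    using lborel_integral_real_affine[of "-1" "\<lambda>t. indicator {0..1} t *\<^sub>R F t" 1] by simp
qed

lemma set_lint_path_shift: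
  assumes U: "path U" "U 0 = U 1" and \<theta>: "\<theta> \<in> {0..<1}" and B: "closed B"
  shows "(LINT t:{0..1}|lborel. indicator B (U (frac (t + \<theta>)))) = (LINT t:{0..1}|lborel. indicator B (U t) :: real)"
    and "(LINT t:{0..1}|lborel. indicator B (U (frac (\<theta> - t)))) = (LINT t:{0..1}|lborel. indicator B (U t) :: real)"
proof -
  let ?F = "\<lambda>t. indicator B (U t) :: real"
  have int: "set_integrable lborel {0..1} ?F" by (rule set_integrable_indicator_path[OF U(1) B])
  have ints: "set_integrable lborel {0..1} (\<lambda>t. ?F (frac (t + \<theta>)))"
    by (rule set_integrable_indicator_path[OF path_frac_shift(1)[OF U \<theta>] B])
  have "set_integrable lborel {0..<1} ?F" by (auto intro: set_integrable_subset[OF int])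
  from set_lint_frac_shift[OF this \<theta>]
  show 1: "(LINT t:{0..1}|lborel. ?F (frac (t + \<theta>))) = (LINT t:{0..1}|lborel. ?F t)"
    by (simp add: set_lint_unit_half_open[OF int] set_lint_unit_half_open[OF ints])
  have "frac (1 - t + \<theta>) = frac (\<theta> - t)" for t
    using frac_1_eq[of "\<theta> - t"] by (simp add: algebra_simps)
  then show "(LINT t:{0..1}|lborel. ?F (frac (\<theta> - t))) = (LINT t:{0..1}|lborel. ?F t)"
    using 1 set_lint_unit_reverse[of "\<lambda>t. ?F (frac (t + \<theta>))"] by simp
qed

text \<open>Substituting \<open>s = L * t\<close> produces a factor \<open>L\<close> that cancels
  the normalization of the measure.\<close>

lemma arc_measure_unit_rep:
  assumes "C \<in> curve_space"
  shows "arc_measure C B = (LINT t:{0..1}|lborel. indicator B (unit_rep C t))"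
proof -
  let ?L = "curve_length C"
  have L: "?L > 0"
    unfolding curve_length_def using path_length_pos[OF representative_param_curves[OF assms]] .
  have "indicator {0..?L} (0 + ?L * t) = (indicator {0..1} t :: real)" for t
    using L by (auto simp: indicator_def zero_le_mult_iff mult_le_cancel_left1)
  then have "(LINT s:{0..?L}|lborel. indicator B (arc_rep C s)) =
      ?L * (LINT t:{0..1}|lborel. indicator B (unit_rep C t) :: real)"
    unfolding set_lebesgue_integral_def unit_rep_def
    using lborel_integral_real_affine[of ?L "\<lambda>s. indicator {0..?L} s *\<^sub>R (indicator B (arc_rep C s) :: real)" 0] L
    by simp
  then show ?thesis using L by (simp add: arc_measure_def)
qed

lemma set_lint_cong_unit:
  assumes "\<And>t. t \<in> {0..1::real} \<Longrightarrow> F t = (G t :: real)"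
  shows "(LINT t:{0..1}|lborel. F t) = (LINT t:{0..1}|lborel. G t)"
  using assms by (intro set_lebesgue_integral_cong) auto

subsection \<open>Degree modulo 2 under orthogonal maps\<close>

text \<open>Multiplication by \<open>c\<close> adds the constant \<open>Ln c\<close> to a continuous
  logarithm of the path and leaves its increment unchanged.\<close>

lemma winding_number_times_const:
  assumes "path z" "0 \<notin> path_image z" "c \<noteq> 0"
  shows "winding_number (\<lambda>t. c * z t) 0 = winding_number z 0"
proof -
  obtain q where q: "path q"
    and wq: "pathfinish q - pathstart q = 2 * of_real pi * \<i> * winding_number z 0"
    and zq: "\<And>t. t \<in> {0..1} \<Longrightarrow> z t = 0 + exp (q t)"
    using winding_number_as_continuous_log[OF assms(1,2)] by metis
  let ?q = "\<lambda>t. Ln c + q t"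
  have "winding_number (\<lambda>t. c * z t) 0 = winding_number (exp \<circ> ?q) 0"
    using zq assms(3) by (intro winding_number_cong) (simp add: exp_add)
  also have "\<dots> = (pathfinish ?q - pathstart ?q) / (2 * of_real pi * \<i>)"
    using q by (intro winding_number_compose_exp) (auto simp: path_def intro!: continuous_intros)
  also have "\<dots> = winding_number z 0"
    using wq by (simp add: pathfinish_def pathstart_def)
  finally show ?thesis .
qed

definition plane_to_complex :: "plane \<Rightarrow> complex" where
  "plane_to_complex v = Complex (v $ 1) (v $ 2)"

lemma continuous_on_plane_to_complex: "continuous_on S plane_to_complex"
  unfolding plane_to_complex_def by (intro continuous_intros)

lemma plane_to_complex_eq_0_iff: "plane_to_complex v = 0 \<longleftrightarrow> v = 0"
  by (simp add: plane_to_complex_def complex_eq_iff vec_eq_iff forall_2)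

text \<open>With the first column read as the complex number \<open>c\<close>, the second is
  \<open>c\<close> turned by a right angle one way or the other. The two signs give rotations and
  reflections.\<close>

lemma orthogonal_matrix_2_complex:
  assumes "orthogonal_matrix (Q :: real^2^2)"
  obtains c where "c \<noteq> 0" "\<And>v. plane_to_complex (Q *v v) = c * plane_to_complex v"
  | c where "c \<noteq> 0" "\<And>v. plane_to_complex (Q *v v) = c * cnj (plane_to_complex v)"
proof -
  define p q s t where pq: "p = Q $ 1 $ 1" "q = Q $ 1 $ 2" "s = Q $ 2 $ 1" "t = Q $ 2 $ 2"
  have "transpose Q ** Q = mat 1" using assms by (simp add: orthogonal_matrix_def)
  then have ps: "p * p + s * s = 1" and qt: "q * q + t * t = 1" and pqst: "p * q + s * t = 0"
    by (simp_all add: vec_eq_iff forall_2 matrix_matrix_mult_def sum_2 transpose_def mat_def pq algebra_simps)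
  \<comment> \<open>The determinant: Lagrange's identity gives \<open>d * d = 1\<close>, and the
    second column is \<open>d\<close> times the quarter turn of the first.\<close>
  define d where "d = p * t - q * s"
  have Qv: "plane_to_complex (Q *v v) = Complex (p * v $ 1 + q * v $ 2) (s * v $ 1 + t * v $ 2)" for v
    by (simp add: plane_to_complex_def matrix_vector_mult_def sum_2 pq)
  have c0: "Complex p s \<noteq> 0" using ps by (auto simp: complex_eq_iff)
  have "d * d = (p * p + s * s) * (q * q + t * t) - (p * q + s * t) * (p * q + s * t)"
    unfolding d_def by algebra
  then have "d * d = 1" using ps qt pqst by simp
  moreover have "t = d * p" "q = - d * s"
    using ps qt pqst unfolding d_def by algebra+
  ultimately consider "t = p" "q = - s" | "t = - p" "q = s"
    using square_eq_1_iff[of d] by (auto simp: power2_eq_square)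
  then show thesis
  proof cases
    case 1
    then have "plane_to_complex (Q *v v) = Complex p s * plane_to_complex v" for v
      by (simp add: Qv) (simp add: plane_to_complex_def complex_eq_iff algebra_simps)
    then show thesis using that(1) c0 by blast
  next
    case 2
    then have "plane_to_complex (Q *v v) = Complex p s * cnj (plane_to_complex v)" for v
      by (simp add: Qv) (simp add: plane_to_complex_def complex_eq_iff algebra_simps)
    then show thesis using that(2) c0 by blast
  qed
qed

lemma circle_degree_orthogonal:
  assumes u: "path u" "u 0 = u 1" "0 \<notin> path_image u" and Q: "orthogonal_matrix Q"
    and u': "\<And>t. t \<in> {0..1} \<Longrightarrow> u' t = Q *v u t"
  shows "circle_degree u' mod 2 = circle_degree u mod 2"
proof -
  define z where "z = plane_to_complex \<circ> u"
  have deg: "circle_degree v = \<lfloor>Re (winding_number (plane_to_complex \<circ> v) 0)\<rfloor>" for v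
    by (simp add: circle_degree_def plane_to_complex_def comp_def)
  have z: "path z" unfolding z_def
    using u(1) by (intro path_continuous_image continuous_on_plane_to_complex)
  have z0: "0 \<notin> path_image z"
    using u(3) plane_to_complex_eq_0_iff by (force simp: z_def path_image_compose)
  \<comment> \<open>Integrality matters in the reflected case: the floor in
    \<open>circle_degree\<close> commutes with negation only at integers.\<close>
  have "winding_number z 0 \<in> \<int>"
    using z z0 u(2) by (intro integer_winding_number) (auto simp: z_def pathfinish_def pathstart_def)
  then obtain n where n: "winding_number z 0 = of_int n" by (auto elim: Ints_cases)
  from Q show ?thesis
  proof (cases rule: orthogonal_matrix_2_complex)
    case (1 c)
    have "winding_number (plane_to_complex \<circ> u') 0 = winding_number (\<lambda>t. c * z t) 0"
      by (rule winding_number_cong) (simp add: u' 1 z_def)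
    then show ?thesis using winding_number_times_const[OF z z0 1(1)] by (simp add: deg z_def)
  next
    case (2 c)
    have "path (cnj \<circ> z)" using z by (intro path_continuous_image continuous_intros)
    moreover have "0 \<notin> path_image (cnj \<circ> z)" using z0 by (auto simp: path_image_def)
    moreover have "winding_number (plane_to_complex \<circ> u') 0 = winding_number (\<lambda>t. c * (cnj \<circ> z) t) 0"
      by (rule winding_number_cong) (simp add: u' 2 z_def)
    ultimately have "winding_number (plane_to_complex \<circ> u') 0 = winding_number (cnj \<circ> z) 0"
      using winding_number_times_const[of "cnj \<circ> z" c] 2(1) by simp
    also have "\<dots> = of_int (- n)" using winding_number_cnj[OF z z0] n by simp
    finally have "circle_degree u' = - n" unfolding deg by simp
    moreover have "circle_degree u = n" using n by (simp add: deg z_def)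
    ultimately show ?thesis by presburger
  qed
qed

lemma path_band_loop:
  assumes "path \<alpha>" "path \<beta>"
  shows "path (band_loop \<alpha> \<beta>)" "band_loop \<alpha> \<beta> 0 = band_loop \<alpha> \<beta> 1"
proof -
  have "band_loop \<alpha> \<beta> = (\<alpha> +++ linepath (pathfinish \<alpha>) (pathfinish \<beta>)) +++
      (reversepath \<beta> +++ linepath (pathstart \<beta>) (pathstart \<alpha>))"
    by (simp add: band_loop_def pathstart_def pathfinish_def)
  then show "path (band_loop \<alpha> \<beta>)" using assms by simp
qed (simp add: band_loop_def joinpaths_def reversepath_def linepath_def)

subsection \<open>Equivariance of measures and bands\<close>

context similarity
begin

text \<open>Closedness of \<open>B\<close> serves the closed curves: shifting cuts the integral into
  two pieces, which requires integrability.\<close>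

lemma arc_measure_image:
  assumes C: "C \<in> curve_space" and B: "closed B"
  shows "arc_measure (curve_image g C) (g ` B) = arc_measure C B"
proof -
  let ?U = "unit_rep C" and ?U' = "unit_rep (curve_image g C)"
  have ind: "indicator (g ` B) (g x) = (indicator B x :: real)" for x
    using inj_g by (simp add: indicator_def inj_image_mem_iff)
  have "(LINT t:{0..1}|lborel. indicator (g ` B) (?U' t)) = (LINT t:{0..1}|lborel. indicator B (?U t) :: real)"
  proof (cases C)
    case (Inl c)
    then have c: "c \<in> param_curves // open_rel" using C by (auto simp: curve_space_def)
    from unit_rep_image_open[OF c] consider
      "\<And>t. t \<in> {0..1} \<Longrightarrow> ?U' t = g (?U t)" | "\<And>t. t \<in> {0..1} \<Longrightarrow> ?U' t = g (?U (1 - t))"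
      using Inl by blast
    then show ?thesis
    proof cases
      case 1
      then show ?thesis by (intro set_lint_cong_unit) (simp add: ind)
    next
      case 2
      then have "(LINT t:{0..1}|lborel. indicator (g ` B) (?U' t)) =
          (LINT t:{0..1}|lborel. indicator B (?U (1 - t)) :: real)"
        by (intro set_lint_cong_unit) (simp add: ind)
      then show ?thesis using set_lint_unit_reverse[of "\<lambda>t. indicator B (?U t)"] by simp
    qed
  next
    case (Inr c)
    then have c: "c \<in> param_loops // closed_rel" using C by (auto simp: curve_space_def)
    have U: "path ?U" "?U 0 = ?U 1" using path_unit_rep[OF C] unit_rep_closed[OF c] Inr by auto
    obtain \<theta> where \<theta>: "\<theta> \<in> {0..<1}" and "(\<forall>t\<in>{0..1}. ?U' t = g (?U (frac (t + \<theta>)))) \<or>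
        (\<forall>t\<in>{0..1}. ?U' t = g (?U (frac (\<theta> - t))))"
      using unit_rep_image_closed[OF c] Inr by blast
    then consider "\<And>t. t \<in> {0..1} \<Longrightarrow> ?U' t = g (?U (frac (t + \<theta>)))"
      | "\<And>t. t \<in> {0..1} \<Longrightarrow> ?U' t = g (?U (frac (\<theta> - t)))" by blast
    then show ?thesis
    proof cases
      case 1
      then have "(LINT t:{0..1}|lborel. indicator (g ` B) (?U' t)) =
          (LINT t:{0..1}|lborel. indicator B (?U (frac (t + \<theta>))) :: real)"
        by (intro set_lint_cong_unit) (simp add: ind)
      then show ?thesis using set_lint_path_shift(1)[OF U \<theta> B] by simp
    next
      case 2
      then have "(LINT t:{0..1}|lborel. indicator (g ` B) (?U' t)) =
          (LINT t:{0..1}|lborel. indicator B (?U (frac (\<theta> - t))) :: real)"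
        by (intro set_lint_cong_unit) (simp add: ind)
      then show ?thesis using set_lint_path_shift(2)[OF U \<theta> B] by simp
    qed
  qed
  then show ?thesis
    using arc_measure_unit_rep[OF C] arc_measure_unit_rep[OF curve_image_in_curve_space[OF C]] by simp
qed

lemma global_band_image:
  assumes "A \<in> curve_space" "B \<in> curve_space"
  shows "global_band (curve_image g A) (curve_image g B) = g ` global_band A B"
  unfolding global_band_def trace_of_image[OF assms(1)] trace_of_image[OF assms(2)]
proof (intro set_eqI iffI)
  fix p
  assume "p \<in> {(1 - l) *\<^sub>R x + l *\<^sub>R y |l x y. x \<in> g ` trace_of A \<and> y \<in> g ` trace_of B \<and> l \<in> {0..1}}"
  then obtain l x y where "p = (1 - l) *\<^sub>R g x + l *\<^sub>R g y" "x \<in> trace_of A" "y \<in> trace_of B" "l \<in> {0..1}"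
    by auto
  then show "p \<in> g ` {(1 - l) *\<^sub>R x + l *\<^sub>R y |l x y. x \<in> trace_of A \<and> y \<in> trace_of B \<and> l \<in> {0..1}}"
    unfolding g_convex_comb[symmetric] by blast
qed (force simp: g_convex_comb)

lemma linepath_g: "linepath (g x) (g y) t = g (linepath x y t)"
  by (simp add: linepath_def g_convex_comb)

lemma band_loop_image:
  assumes "\<And>t. t \<in> {0..1} \<Longrightarrow> \<alpha>' t = g (\<alpha> t)" "\<And>t. t \<in> {0..1} \<Longrightarrow> \<beta>' t = g (\<beta> t)"
    and "t \<in> {0..1}"
  shows "band_loop \<alpha>' \<beta>' t = g (band_loop \<alpha> \<beta> t)"
  using assms by (auto simp: band_loop_def joinpaths_def reversepath_def linepath_g)

text \<open>Normalization removes \<open>r\<close> and \<open>Q\<close> preserves norms, so the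
  direction from \<open>g p\<close> to the image loop is \<open>Q\<close> applied to the original
  direction.\<close>

lemma degree_mod2_image:
  assumes \<gamma>: "path \<gamma>" "\<gamma> 0 = \<gamma> 1" "p \<notin> path_image \<gamma>"
    and \<gamma>': "\<And>t. t \<in> {0..1} \<Longrightarrow> \<gamma>' t = g (\<gamma> t)"
  shows "degree_mod2 \<gamma>' (g p) = degree_mod2 \<gamma> p"
  unfolding degree_mod2_def
proof (rule circle_degree_orthogonal[OF _ _ _ orth])
  have ne: "\<gamma> t - p \<noteq> 0" if "t \<in> {0..1}" for t using \<gamma>(3) that by (auto simp: path_image_def)
  then show "path (\<lambda>t. (\<gamma> t - p) /\<^sub>R norm (\<gamma> t - p))"
    using \<gamma>(1) unfolding path_def by (intro continuous_intros) auto
  show "0 \<notin> path_image (\<lambda>t. (\<gamma> t - p) /\<^sub>R norm (\<gamma> t - p))"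
    using ne by (auto simp: path_image_def)
  show "(\<gamma> 0 - p) /\<^sub>R norm (\<gamma> 0 - p) = (\<gamma> 1 - p) /\<^sub>R norm (\<gamma> 1 - p)" using \<gamma>(2) by simp
  fix t :: real assume t: "t \<in> {0..1}"
  have "\<gamma>' t - g p = r *\<^sub>R (Q *v (\<gamma> t - p))"
    using \<gamma>'[OF t] by (simp add: g_eq matrix_vector_mult_diff_distrib scaleR_diff_right)
  then show "(\<gamma>' t - g p) /\<^sub>R norm (\<gamma>' t - g p) = Q *v ((\<gamma> t - p) /\<^sub>R norm (\<gamma> t - p))"
    using r_pos by (simp add: norm_Q matrix_vector_mult_scaleR)
qed

lemma filled_band_image:
  assumes \<alpha>: "path \<alpha>" and \<beta>: "path \<beta>"
    and \<alpha>': "\<And>t. t \<in> {0..1} \<Longrightarrow> \<alpha>' t = g (\<alpha> t)" and \<beta>': "\<And>t. t \<in> {0..1} \<Longrightarrow> \<beta>' t = g (\<beta> t)"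
  shows "filled_band \<alpha>' \<beta>' = g ` filled_band \<alpha> \<beta>"
proof -
  have wall: "band_wall \<alpha>' \<beta>' = g ` band_wall \<alpha> \<beta>"
    using band_loop_image[of \<alpha>' \<alpha> \<beta>' \<beta>, OF \<alpha>' \<beta>']
    by (auto simp: band_wall_def path_image_def image_image intro!: image_cong)
  have deg: "degree_mod2 (band_loop \<alpha>' \<beta>') (g p) = degree_mod2 (band_loop \<alpha> \<beta>) p"
    if "p \<notin> band_wall \<alpha> \<beta>" for p
    using degree_mod2_image[OF path_band_loop[OF \<alpha> \<beta>], of p "band_loop \<alpha>' \<beta>'"] that
      band_loop_image[of \<alpha>' \<alpha> \<beta>' \<beta>, OF \<alpha>' \<beta>'] by (auto simp: band_wall_def)
  have "g p \<in> filled_band \<alpha>' \<beta>' \<longleftrightarrow> p \<in> filled_band \<alpha> \<beta>" for p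
    using deg[of p] inj_g by (auto simp: filled_band_def wall inj_image_mem_iff)
  \<comment> \<open>Membership has been compared only at points \<open>g p\<close>; surjectivity
    makes these all points of the plane.\<close>
  moreover have "\<exists>p. q = g p" for q using surj_g by (metis surjD)
  ultimately have "q \<in> filled_band \<alpha>' \<beta>' \<longleftrightarrow> q \<in> g ` filled_band \<alpha> \<beta>" for q
    using g_eq_iff by (metis image_iff)
  then show ?thesis by blast
qed

lemma endpoint_gap_image:
  assumes "\<forall>t\<in>{0..1}. \<alpha>' t = g (\<alpha> t)" "\<forall>t\<in>{0..1}. \<beta>' t = g (\<beta> t)"
  shows "endpoint_gap \<alpha>' \<beta>' = r * endpoint_gap \<alpha> \<beta>"
  using assms by (simp add: endpoint_gap_def norm_g_diff distrib_left)

text \<open>Minimality quantifies over all competitors, so each direction uses its own half of the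
  matching: competitors are pushed forward for one and pulled back for the other, and the common
  factor \<open>r > 0\<close> preserves the order.\<close>

lemma optimal_pairs_image:
  assumes A: "A \<in> curve_space" and B: "B \<in> curve_space"
    and t: "\<alpha> \<in> traversals A" "\<beta> \<in> traversals B"
      "\<alpha>' \<in> traversals (curve_image g A)" "\<beta>' \<in> traversals (curve_image g B)"
    and eq: "\<forall>t\<in>{0..1}. \<alpha>' t = g (\<alpha> t)" "\<forall>t\<in>{0..1}. \<beta>' t = g (\<beta> t)"
  shows "(\<alpha>', \<beta>') \<in> optimal_pairs (curve_image g A) (curve_image g B) \<longleftrightarrow> (\<alpha>, \<beta>) \<in> optimal_pairs A B"
proof -
  note gap = endpoint_gap_image[OF eq]
  have "(\<forall>a'\<in>traversals (curve_image g A). \<forall>b'\<in>traversals (curve_image g B).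
      endpoint_gap \<alpha>' \<beta>' \<le> endpoint_gap a' b') \<longleftrightarrow>
    (\<forall>a\<in>traversals A. \<forall>b\<in>traversals B. endpoint_gap \<alpha> \<beta> \<le> endpoint_gap a b)" (is "?L \<longleftrightarrow> ?R")
  proof
    assume L: ?L
    show ?R
    proof (intro ballI)
      fix a b assume ab: "a \<in> traversals A" "b \<in> traversals B"
      obtain a' where a': "a' \<in> traversals (curve_image g A)" "\<forall>t\<in>{0..1}. a' t = g (a t)"
        using traversal_image[OF A ab(1)] .
      obtain b' where b': "b' \<in> traversals (curve_image g B)" "\<forall>t\<in>{0..1}. b' t = g (b t)"
        using traversal_image[OF B ab(2)] .
      have "endpoint_gap \<alpha>' \<beta>' \<le> endpoint_gap a' b'" using L a'(1) b'(1) by blast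
      then show "endpoint_gap \<alpha> \<beta> \<le> endpoint_gap a b"
        using gap endpoint_gap_image[OF a'(2) b'(2)] r_pos by simp
    qed
  next
    assume R: ?R
    show ?L
    proof (intro ballI)
      fix a' b' assume ab': "a' \<in> traversals (curve_image g A)" "b' \<in> traversals (curve_image g B)"
      obtain a where a: "a \<in> traversals A" "\<forall>t\<in>{0..1}. a' t = g (a t)"
        using traversal_preimage[OF A ab'(1)] .
      obtain b where b: "b \<in> traversals B" "\<forall>t\<in>{0..1}. b' t = g (b t)"
        using traversal_preimage[OF B ab'(2)] .
      have "endpoint_gap \<alpha> \<beta> \<le> endpoint_gap a b" using R a(1) b(1) by blast
      then show "endpoint_gap \<alpha>' \<beta>' \<le> endpoint_gap a' b'"
        using gap endpoint_gap_image[OF a(2) b(2)] r_pos by simp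
    qed
  qed
  then show ?thesis using t by (simp add: optimal_pairs_def)
qed

text \<open>Splits \<open>g\<close> into an injective linear map and a translation, both of which
  commute with closure.\<close>

lemma closure_g_image: "closure (g ` S) = g ` closure S"
proof -
  let ?h = "\<lambda>x. r *\<^sub>R (Q *v x)"
  have g: "g ` T = (\<lambda>x. b + x) ` ?h ` T" for T by (auto simp: g_eq image_image add.commute)
  have lin: "linear ?h"
    by (intro linear_compose_scale_right matrix_vector_mul_linear)
  have "inj ?h" using inj_g by (auto simp: inj_def g_eq)
  from closure_injective_linear_image[OF lin this] show ?thesis
    by (simp only: g closure_translation)
qed

lemma fw_band_image:
  assumes A: "A \<in> curve_space" and B: "B \<in> curve_space"
  shows "fw_band (curve_image g A) (curve_image g B) = g ` fw_band A B"
proof -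
  let ?A = "curve_image g A" and ?B = "curve_image g B"
  have fb: "filled_band \<alpha>' \<beta>' = g ` filled_band \<alpha> \<beta>"
    if "\<alpha> \<in> traversals A" "\<beta> \<in> traversals B"
      "\<forall>t\<in>{0..1}. \<alpha>' t = g (\<alpha> t)" "\<forall>t\<in>{0..1}. \<beta>' t = g (\<beta> t)" for \<alpha> \<beta> \<alpha>' \<beta>'
    using filled_band_image[of \<alpha> \<beta> \<alpha>' \<beta>'] that path_traversals A B by blast
  have "(\<Union>(\<alpha>, \<beta>)\<in>optimal_pairs ?A ?B. filled_band \<alpha> \<beta>) =
    g ` (\<Union>(\<alpha>, \<beta>)\<in>optimal_pairs A B. filled_band \<alpha> \<beta>)" (is "?L = ?R")
  proof
    show "?L \<subseteq> ?R"
    proof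
      fix p assume "p \<in> ?L"
      then obtain \<alpha>' \<beta>' where opt: "(\<alpha>', \<beta>') \<in> optimal_pairs ?A ?B" and p: "p \<in> filled_band \<alpha>' \<beta>'"
        by auto
      then have t': "\<alpha>' \<in> traversals ?A" "\<beta>' \<in> traversals ?B" by (auto simp: optimal_pairs_def)
      obtain \<alpha> \<beta> where t: "\<alpha> \<in> traversals A" "\<beta> \<in> traversals B"
        and eq: "\<forall>t\<in>{0..1}. \<alpha>' t = g (\<alpha> t)" "\<forall>t\<in>{0..1}. \<beta>' t = g (\<beta> t)"
        using traversal_preimage[OF A t'(1)] traversal_preimage[OF B t'(2)] by metis
      have "(\<alpha>, \<beta>) \<in> optimal_pairs A B" using optimal_pairs_image[OF A B t t' eq] opt by simp
      then show "p \<in> ?R" using p fb[OF t eq] by blast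
    qed
    show "?R \<subseteq> ?L"
    proof
      fix p assume "p \<in> ?R"
      then obtain \<alpha> \<beta> where opt: "(\<alpha>, \<beta>) \<in> optimal_pairs A B" and p: "p \<in> g ` filled_band \<alpha> \<beta>"
        by auto
      then have t: "\<alpha> \<in> traversals A" "\<beta> \<in> traversals B" by (auto simp: optimal_pairs_def)
      obtain \<alpha>' \<beta>' where t': "\<alpha>' \<in> traversals ?A" "\<beta>' \<in> traversals ?B"
        and eq: "\<forall>t\<in>{0..1}. \<alpha>' t = g (\<alpha> t)" "\<forall>t\<in>{0..1}. \<beta>' t = g (\<beta> t)"
        using traversal_image[OF A t(1)] traversal_image[OF B t(2)] by metis
      have "(\<alpha>', \<beta>') \<in> optimal_pairs ?A ?B" using optimal_pairs_image[OF A B t t' eq] opt by simp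
      then show "p \<in> ?L" using p fb[OF t eq] by blast
    qed
  qed
  then show ?thesis by (simp add: fw_band_def closure_g_image)
qed

end

section \<open>Closedness of the bands and invariance of the depths\<close>

text \<open>The band is a continuous image of the compact set of triples \<open>(l, x, y)\<close>;
  closedness is what \<open>arc_measure_image\<close> asks for.\<close>

lemma closed_global_band:
  assumes "A \<in> curve_space" "B \<in> curve_space"
  shows "closed (global_band A B)"
proof -
  let ?F = "\<lambda>(l :: real, x :: plane, y). (1 - l) *\<^sub>R x + l *\<^sub>R y"
  have "compact (?F ` ({0..1} \<times> trace_of A \<times> trace_of B))"
    using assms by (intro compact_continuous_image compact_Times compact_trace_of)
      (auto simp: case_prod_unfold intro!: continuous_intros)
  also have "?F ` ({0..1} \<times> trace_of A \<times> trace_of B) = global_band A B"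
    by (force simp: global_band_def)
  finally show ?thesis by (rule compact_imp_closed)
qed

lemma closed_fw_band: "closed (fw_band A B)"
  by (simp add: fw_band_def)

lemma depth_cong:
  assumes "\<And>i j. 1 \<le> i \<Longrightarrow> i < j \<Longrightarrow> j \<le> n \<Longrightarrow>
    arc_measure C (R (Cs i) (Cs j)) = arc_measure C' (R (Cs' i) (Cs' j))"
  shows "integral_depth R C n Cs = integral_depth R C' n Cs'"
    and "infimal_depth R C n Cs = infimal_depth R C' n Cs'"
  using assms unfolding integral_depth_def infimal_depth_def
  by (auto intro!: sum.cong arg_cong2[where f = "(/)"])

theorem proposition4p3:
  fixes n :: nat and C :: curve and Cs :: "nat \<Rightarrow> curve"
    and g :: "real ^ 2 \<Rightarrow> real ^ 2" and r :: real and Q :: "real ^ 2 ^ 2" and b :: "real ^ 2"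
  assumes "n \<ge> 2"
    and "C \<in> curve_space" and "curve_length C > 0" and "non_atomic (arc_measure C)"
    and "\<And>i. i \<in> {1..n} \<Longrightarrow> Cs i \<in> curve_space"
    and "\<And>i. i \<in> {1..n} \<Longrightarrow> curve_length (Cs i) > 0"
    and "\<And>i. i \<in> {1..n} \<Longrightarrow> non_atomic (arc_measure (Cs i))"
    and "r > 0" and "orthogonal_matrix Q"
    and "\<And>x. g x = r *\<^sub>R (Q *v x) + b"
  shows "\<forall>D \<in> {D_int, D_inf, D_FW, D_FW_inf}.
           D C n Cs = D (curve_image g C) n (\<lambda>i. curve_image g (Cs i))"
proof -
  interpret similarity g r Q b using assms by unfold_locales
  have global: "arc_measure C (global_band (Cs i) (Cs j)) =
      arc_measure (curve_image g C) (global_band (curve_image g (Cs i)) (curve_image g (Cs j)))"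
    if "1 \<le> i" "i < j" "j \<le> n" for i j
    using assms(2,5) that by (simp add: global_band_image arc_measure_image closed_global_band)
  have fw: "arc_measure C (fw_band (Cs i) (Cs j)) =
      arc_measure (curve_image g C) (fw_band (curve_image g (Cs i)) (curve_image g (Cs j)))"
    if "1 \<le> i" "i < j" "j \<le> n" for i j
    using assms(2,5) that by (simp add: fw_band_image arc_measure_image closed_fw_band)
  show ?thesis
    using depth_cong[of n C global_band Cs "curve_image g C" "\<lambda>i. curve_image g (Cs i)", OF global]
      depth_cong[of n C fw_band Cs "curve_image g C" "\<lambda>i. curve_image g (Cs i)", OF fw]
    by (simp add: D_int_def D_inf_def D_FW_def D_FW_inf_def)
qed

end
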